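(* Let $d\in\{1,2\}$ and $Q\in L^2_{\mathrm{loc}}(\mathbb{R}^d)$ real-valued. Suppose $H_Q$ is bounded below with ground-state energy $E_0=\inf\sigma(H_Q)$, and that $H_Q$ has a bounded positive ground state, i.e. a bounded function $\psi>0$ (in $W^{1,1}_{\mathrm{loc}}$) which is a distributional solution of $-\nabla^2\psi+Q\psi=E_0\psi$. If $V\in L^2_{\mathrm{loc}}(\mathbb{R}^d)$ is real-valued and both $H_{Q+V}$ and $H_{Q-V}$ are bounded below by $E_0$ (i.e. $\int\|\nabla\phi\|^2+(Q\pm V)|\phi|^2\ge E_0\int|\phi|^2$ for all $\phi\in C_c^\infty(\mathbb{R}^d)$), then $V\equiv0$.
   Context: For a real potential $W$ on $\mathbb{R}^d$, $H_W=-\nabla^2+W$ is the Schrödinger operator on $L^2(\mathbb{R}^d)$, defined through its quadratic form $\int\|\nabla\phi\|^2+W|\phi|^2$. The ground-state energy is the infimum of the spectrum; a ground state is a distributional solution of $-\nabla^2\psi+Q\psi=E_0\psi$ with $E_0$ the ground-state energy. *)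

theory Defs
  imports "HOL-Analysis.Analysis"
begin

definition pd :: "'a::euclidean_space \<Rightarrow> ('a \<Rightarrow> 'b::real_normed_vector) \<Rightarrow> 'a \<Rightarrow> 'b" where
  "pd b f x = vector_derivative (\<lambda>t::real. f (x + t *\<^sub>R b)) (at 0)"

text \<open>C-infinity: all iterated partial derivatives exist everywhere and are continuous.\<close>
definition smooth_fun :: "('a::euclidean_space \<Rightarrow> 'b::real_normed_vector) \<Rightarrow> bool" where
  "smooth_fun f \<longleftrightarrow> (\<exists>S. f \<in> S \<and> (\<forall>g\<in>S. continuous_on UNIV g \<and>
      (\<forall>b\<in>Basis. \<exists>g'\<in>S. \<forall>x. ((\<lambda>t::real. g (x + t *\<^sub>R b)) has_vector_derivative g' x) (at 0))))"

definition test_fun :: "('a::euclidean_space \<Rightarrow> 'b::real_normed_vector) \<Rightarrow> bool" where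
  "test_fun f \<longleftrightarrow> smooth_fun f \<and> compact (closure {x. f x \<noteq> 0})"

definition laplacian :: "('a::euclidean_space \<Rightarrow> real) \<Rightarrow> 'a \<Rightarrow> real" where
  "laplacian f x = (\<Sum>b\<in>Basis. pd b (pd b f) x)"

definition L1_loc :: "('a::euclidean_space \<Rightarrow> real) \<Rightarrow> bool" where
  "L1_loc f \<longleftrightarrow> f \<in> borel_measurable lborel \<and> (\<forall>K. compact K \<longrightarrow> set_integrable lborel K f)"

definition L2_loc :: "('a::euclidean_space \<Rightarrow> real) \<Rightarrow> bool" where
  "L2_loc f \<longleftrightarrow> f \<in> borel_measurable lborel \<and>
     (\<forall>K. compact K \<longrightarrow> set_integrable lborel K (\<lambda>x. (f x)\<^sup>2))"

definition W11_loc :: "('a::euclidean_space \<Rightarrow> real) \<Rightarrow> bool" where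
  "W11_loc f \<longleftrightarrow> L1_loc f \<and> (\<forall>b\<in>Basis. \<exists>g. L1_loc g \<and>
     (\<forall>\<phi>::'a \<Rightarrow> real. test_fun \<phi> \<longrightarrow>
        (\<integral>x. f x * pd b \<phi> x \<partial>lborel) = - (\<integral>x. g x * \<phi> x \<partial>lborel)))"

definition qform :: "('a::euclidean_space \<Rightarrow> real) \<Rightarrow> ('a \<Rightarrow> complex) \<Rightarrow> real" where
  "qform W \<phi> = (\<integral>x. (\<Sum>b\<in>Basis. (cmod (pd b \<phi> x))\<^sup>2) + W x * (cmod (\<phi> x))\<^sup>2 \<partial>lborel)"

definition L2normsq :: "('a::euclidean_space \<Rightarrow> complex) \<Rightarrow> real" where
  "L2normsq \<phi> = (\<integral>x. (cmod (\<phi> x))\<^sup>2 \<partial>lborel)"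

text \<open>H_W bounded below, and its ground-state energy inf sigma(H_W), computed via the
  quadratic form on the form core C_c^infinity (Friedrichs extension).\<close>
definition bounded_below_op :: "('a::euclidean_space \<Rightarrow> real) \<Rightarrow> bool" where
  "bounded_below_op W \<longleftrightarrow>
     bdd_below ((\<lambda>\<phi>. qform W \<phi> / L2normsq \<phi>) ` {\<phi>. test_fun \<phi> \<and> \<phi> \<noteq> (\<lambda>_. 0)})"

definition ground_state_energy :: "('a::euclidean_space \<Rightarrow> real) \<Rightarrow> real" where
  "ground_state_energy W =
     (INF \<phi>\<in>{\<phi>. test_fun \<phi> \<and> \<phi> \<noteq> (\<lambda>_. 0)}. qform W \<phi> / L2normsq \<phi>)"

end

theory Submission
  imports Defs "HOL-Computational_Algebra.Polynomial"
begin

text \<open>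
  Substituting \<open>\<phi> = \<psi>f\<close> turns the form of \<open>H\<^sub>Q - E\<^sub>0\<close> into \<open>\<integral>\<psi>\<^sup>2|\<nabla>f|\<^sup>2\<close>, so the two hypotheses on
  \<open>H\<close> with potentials \<open>Q + V\<close> and \<open>Q - V\<close> say that the quadratic form \<open>b(f, f) = \<integral>V\<psi>\<^sup>2f\<^sup>2\<close> is bounded in
  absolute value by the energy \<open>a(f) = \<integral>\<psi>\<^sup>2|\<nabla>f|\<^sup>2\<close>. Polarizing,
  \<open>2|b(f, g)| \<le> s\<^sup>2a(f) + s\<^sup>-\<^sup>2a(g)\<close> for all \<open>s\<close>. As \<open>\<psi>\<close> is bounded and the dimension is at most two,
  logarithmic cutoffs \<open>f\<^sub>n\<close> converge to a nonzero constant while \<open>a(f\<^sub>n)\<close> tends to 0. Letting first \<open>n\<close>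
  and then \<open>s\<close> tend to infinity gives \<open>\<integral>V\<psi>\<^sup>2g = 0\<close> for every test function \<open>g\<close>.

  Since \<open>\<psi>\<close> is not smooth, the substitution is carried out with mollifications \<open>u\<close> of \<open>\<psi>\<close>.
  Their Laplacian is the mollification of \<open>(Q - E\<^sub>0)\<psi>\<close>, which converges locally in \<open>L\<^sup>1\<close>; together
  with the uniform bound on \<open>u\<close> this suffices to pass to the limit.
\<close>

section \<open>Smooth and test functions\<close>

text \<open>The constant function 1 has zero energy, and polarizing against it would give the claim
  at once, but it is not a test function. Low dimension is what lets compactly supported functions
  imitate it: the cutoff with parameter c has gradient of size at most about c/|x| out to radius
  about exp(1/(2c)). In the plane the integral of c^2/(1 + |x|^2) over that disc is of order c, and
  on the line it is small as well; from dimension three on, the exponentially large radius makes the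
  energy of these cutoffs blow up. The form b is indefinite, so Cauchy-Schwarz cannot be applied to
  b itself. The scale s replaces it: s drops out of b(s f, g/s) but shifts weight between the two
  energies, so that a(g), which is fixed, can be suppressed after a(f_n) has gone to 0. Admissible
  functions are made by multiplying f by a mollification u, never by dividing by psi. Positivity of
  psi enters pointwise at the end, when V psi^2 = 0 is turned into V = 0.\<close>

inductive_set algebra_closure :: "('a \<Rightarrow> real) set \<Rightarrow> ('a \<Rightarrow> real) set"
  for A :: "('a \<Rightarrow> real) set" where
  base: "f \<in> A \<Longrightarrow> f \<in> algebra_closure A"
| const: "(\<lambda>_. c) \<in> algebra_closure A"
| add: "f \<in> algebra_closure A \<Longrightarrow> g \<in> algebra_closure A \<Longrightarrow> (\<lambda>x. f x + g x) \<in> algebra_closure A"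
| mult: "f \<in> algebra_closure A \<Longrightarrow> g \<in> algebra_closure A \<Longrightarrow> (\<lambda>x. f x * g x) \<in> algebra_closure A"

text \<open>\<open>smooth_fun\<close> asks for a set containing \<open>f\<close> that is stable
  under partial derivatives. By the sum and product rules the algebra generated by \<open>A\<close>
  is such a set once the derivatives of the generators stay inside it, so only generators have to be
  checked.\<close>

lemma smooth_fun_algebra_closure:
  fixes A :: "('a::euclidean_space \<Rightarrow> real) set"
  assumes cont: "\<And>g. g \<in> A \<Longrightarrow> continuous_on UNIV g"
    and deriv: "\<And>g b. g \<in> A \<Longrightarrow> b \<in> Basis \<Longrightarrow> \<exists>g'\<in>algebra_closure A.
      \<forall>x. ((\<lambda>t::real. g (x + t *\<^sub>R b)) has_vector_derivative g' x) (at 0)"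
    and f: "f \<in> algebra_closure A"
  shows "smooth_fun f"
  unfolding smooth_fun_def
proof (intro exI conjI ballI)
  show "f \<in> algebra_closure A" by (rule f)
next
  fix g assume "g \<in> algebra_closure A"
  then show "continuous_on UNIV g"
    by induction (auto intro: continuous_intros cont)
next
  fix g and b :: 'a assume "g \<in> algebra_closure A" and b: "b \<in> Basis"
  then show "\<exists>g'\<in>algebra_closure A. \<forall>x. ((\<lambda>t::real. g (x + t *\<^sub>R b)) has_vector_derivative g' x) (at 0)"
  proof induction
    case (base f)
    then show ?case using deriv b by blast
  next
    case (const c)
    show ?case by (rule bexI[of _ "\<lambda>_. 0"]) (auto intro: algebra_closure.const)
  next
    case (add f g)
    then obtain f' g' where *: "f' \<in> algebra_closure A" "g' \<in> algebra_closure A"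
      "\<And>x. ((\<lambda>t::real. f (x + t *\<^sub>R b)) has_vector_derivative f' x) (at 0)"
      "\<And>x. ((\<lambda>t::real. g (x + t *\<^sub>R b)) has_vector_derivative g' x) (at 0)" by blast
    show ?case
      by (rule bexI[of _ "\<lambda>x. f' x + g' x"])
        (auto intro!: algebra_closure.add * has_vector_derivative_add)
  next
    case (mult f g)
    then obtain f' g' where *: "f' \<in> algebra_closure A" "g' \<in> algebra_closure A"
      "\<And>x. ((\<lambda>t::real. f (x + t *\<^sub>R b)) has_vector_derivative f' x) (at 0)"
      "\<And>x. ((\<lambda>t::real. g (x + t *\<^sub>R b)) has_vector_derivative g' x) (at 0)" by blast
    have "((\<lambda>t::real. f (x + t *\<^sub>R b) * g (x + t *\<^sub>R b)) has_vector_derivative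
        f x * g' x + f' x * g x) (at 0)" for x
      using has_vector_derivative_mult[OF *(3,4)[of x]] by simp
    then show ?case
      by (intro bexI[of _ "\<lambda>x. f x * g' x + f' x * g x"])
        (auto intro!: algebra_closure.add algebra_closure.mult mult *)
  qed
qed

text \<open>Derivatives are unique, so every witness set \<open>S\<close> contains the functions
  \<open>pd b f\<close>, and the same \<open>S\<close> witnesses their smoothness.\<close>

lemma smooth_funD:
  fixes f :: "'a::euclidean_space \<Rightarrow> 'b::real_normed_vector"
  assumes "smooth_fun f"
  shows "continuous_on UNIV f"
    and "b \<in> Basis \<Longrightarrow> ((\<lambda>t::real. f (x + t *\<^sub>R b)) has_vector_derivative pd b f x) (at 0)"
    and "b \<in> Basis \<Longrightarrow> smooth_fun (pd b f)"
proof -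
  obtain S where S: "f \<in> S" "\<And>g. g \<in> S \<Longrightarrow> continuous_on UNIV g"
    "\<And>g b. g \<in> S \<Longrightarrow> b \<in> Basis \<Longrightarrow>
      \<exists>g'\<in>S. \<forall>x. ((\<lambda>t::real. g (x + t *\<^sub>R b)) has_vector_derivative g' x) (at 0)"
    using assms unfolding smooth_fun_def by blast
  show "continuous_on UNIV f" using S by blast
  assume b: "b \<in> Basis"
  then obtain g' where g': "g' \<in> S" "\<And>x. ((\<lambda>t::real. f (x + t *\<^sub>R b)) has_vector_derivative g' x) (at 0)"
    using S by blast
  have eq: "pd b f x = g' x" for x
    unfolding pd_def using g'(2) by (rule vector_derivative_at)
  show "((\<lambda>t::real. f (x + t *\<^sub>R b)) has_vector_derivative pd b f x) (at 0)"
    using g' eq by simp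
  have "pd b f = g'" using eq by blast
  moreover have "smooth_fun g'" unfolding smooth_fun_def using S g'(1) by blast
  ultimately show "smooth_fun (pd b f)" by simp
qed

lemma pd_eqI:
  "((\<lambda>t::real. f (x + t *\<^sub>R b)) has_vector_derivative d) (at 0) \<Longrightarrow> pd b f x = d"
  unfolding pd_def by (rule vector_derivative_at)

lemma smooth_fun_real_deriv:
  fixes f :: "'a::euclidean_space \<Rightarrow> real"
  assumes "smooth_fun f" "b \<in> Basis"
  shows "((\<lambda>t. f (x + t *\<^sub>R b)) has_real_derivative pd b f (x + s *\<^sub>R b)) (at s)"
proof -
  have "((\<lambda>t::real. f ((x + s *\<^sub>R b) + t *\<^sub>R b)) has_real_derivative pd b f (x + s *\<^sub>R b)) (at 0)"
    using smooth_funD(2)[OF assms] by (simp add: has_real_derivative_iff_has_vector_derivative)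
  then have "((\<lambda>t::real. f ((x + s *\<^sub>R b) + (t - s) *\<^sub>R b)) has_real_derivative pd b f (x + s *\<^sub>R b)) (at s)"
    using DERIV_shift[of "\<lambda>t. f ((x + s *\<^sub>R b) + (t - s) *\<^sub>R b)" _ 0 s] by (simp add: add.commute)
  then show ?thesis by (simp add: algebra_simps)
qed

lemma smooth_fun_const [simp]: "smooth_fun (\<lambda>x::'a::euclidean_space. c::real)"
  by (rule smooth_fun_algebra_closure[of "{}"]) (auto intro: algebra_closure.const)

lemma
  fixes f g :: "'a::euclidean_space \<Rightarrow> real"
  assumes "smooth_fun f" "smooth_fun g"
  shows smooth_fun_add: "smooth_fun (\<lambda>x. f x + g x)"
    and smooth_fun_mult: "smooth_fun (\<lambda>x. f x * g x)"
proof -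
  \<comment> \<open>With all smooth functions as generators, derivatives of generators are again
    generators, so the generated algebra consists of smooth functions; sums and products belong to
    it by construction.\<close>
  define A where "A = {h::'a \<Rightarrow> real. smooth_fun h}"
  have "smooth_fun h" if "h \<in> algebra_closure A" for h
  proof (rule smooth_fun_algebra_closure[OF _ _ that])
    fix g and b :: 'a assume "g \<in> A" "b \<in> Basis"
    then show "\<exists>g'\<in>algebra_closure A. \<forall>x. ((\<lambda>t::real. g (x + t *\<^sub>R b)) has_vector_derivative g' x) (at 0)"
      using smooth_funD(2,3)[of g] by (intro bexI[of _ "pd b g"]) (auto simp: A_def intro: algebra_closure.base)
  qed (auto simp: A_def dest: smooth_funD(1))
  moreover have "f \<in> algebra_closure A" "g \<in> algebra_closure A"
    using assms by (auto simp: A_def intro: algebra_closure.base)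
  ultimately show "smooth_fun (\<lambda>x. f x + g x)" "smooth_fun (\<lambda>x. f x * g x)"
    by (blast intro: algebra_closure.intros)+
qed

text \<open>The generated algebras are real-valued, so the complex case gets its own witness set. It
  connects the real functions of the argument with \<open>qform\<close>, which takes complex
  ones.\<close>

lemma smooth_fun_of_real:
  fixes f :: "'a::euclidean_space \<Rightarrow> real"
  assumes "smooth_fun f"
  shows "smooth_fun (\<lambda>x. complex_of_real (f x))"
  unfolding smooth_fun_def
proof (intro exI conjI ballI)
  let ?S = "{\<lambda>x::'a. complex_of_real (g x) |g. smooth_fun g}"
  show "(\<lambda>x. complex_of_real (f x)) \<in> ?S" using assms by blast
  show "continuous_on UNIV h" if "h \<in> ?S" for h
  proof -
    obtain g where "h = (\<lambda>x. complex_of_real (g x))" "smooth_fun g" using \<open>h \<in> ?S\<close> by blast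
    then show ?thesis using smooth_funD(1)[of g] by (auto intro!: continuous_intros)
  qed
  show "\<exists>g'\<in>?S. \<forall>x. ((\<lambda>t::real. h (x + t *\<^sub>R b)) has_vector_derivative g' x) (at 0)"
    if "h \<in> ?S" "b \<in> Basis" for h and b :: 'a
  proof -
    obtain g where g: "h = (\<lambda>x. complex_of_real (g x))" "smooth_fun g" using \<open>h \<in> ?S\<close> by blast
    have "(\<lambda>x. complex_of_real (pd b g x)) \<in> ?S"
      using smooth_funD(3)[OF g(2) \<open>b \<in> Basis\<close>] by blast
    moreover have "((\<lambda>t::real. h (x + t *\<^sub>R b)) has_vector_derivative complex_of_real (pd b g x)) (at 0)" for x
      using has_vector_derivative_of_real[OF smooth_fun_real_deriv[OF g(2) \<open>b \<in> Basis\<close>, of x 0]]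
      by (simp add: g(1))
    ultimately show ?thesis by (intro bexI[of _ "\<lambda>x. complex_of_real (pd b g x)"] allI)
  qed
qed

lemma pd_of_real:
  fixes f :: "'a::euclidean_space \<Rightarrow> real"
  assumes "smooth_fun f" "b \<in> Basis"
  shows "pd b (\<lambda>x. complex_of_real (f x)) x = of_real (pd b f x)"
  using has_vector_derivative_of_real[OF smooth_fun_real_deriv[OF assms, of x 0]]
  by (intro pd_eqI) simp

lemma pd_add:
  fixes f g :: "'a::euclidean_space \<Rightarrow> real"
  assumes "smooth_fun f" "smooth_fun g" "b \<in> Basis"
  shows "pd b (\<lambda>x. f x + g x) x = pd b f x + pd b g x"
  by (intro pd_eqI has_vector_derivative_add smooth_funD(2) assms)

lemma pd_mult:
  fixes f g :: "'a::euclidean_space \<Rightarrow> real"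
  assumes "smooth_fun f" "smooth_fun g" "b \<in> Basis"
  shows "pd b (\<lambda>x. f x * g x) x = f x * pd b g x + pd b f x * g x"
  by (intro pd_eqI) (use has_vector_derivative_mult[OF smooth_funD(2)[OF assms(1,3)] smooth_funD(2)[OF assms(2,3)], of x x] in simp)

lemma pd_const: "pd b (\<lambda>x. c) x = 0"
  by (intro pd_eqI) simp

section \<open>Compactly supported smooth functions\<close>

lemma test_fun_iff:
  fixes f :: "'a::euclidean_space \<Rightarrow> 'b::real_normed_vector"
  shows "test_fun f \<longleftrightarrow> smooth_fun f \<and> (\<exists>R. \<forall>x. norm x > R \<longrightarrow> f x = 0)"
proof -
  have "compact (closure {x. f x \<noteq> 0}) \<longleftrightarrow> bounded {x. f x \<noteq> 0}"
    by (metis bounded_closure bounded_subset closed_closure closure_subset compact_eq_bounded_closed)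
  also have "\<dots> \<longleftrightarrow> (\<exists>R. \<forall>x. norm x > R \<longrightarrow> f x = 0)"
    unfolding bounded_iff by (auto simp: not_less[symmetric])
  finally show ?thesis by (simp add: test_fun_def)
qed

lemma test_fun_smooth: "test_fun f \<Longrightarrow> smooth_fun f"
  by (simp add: test_fun_def)

lemma test_fun_support:
  fixes f :: "'a::euclidean_space \<Rightarrow> 'b::real_normed_vector"
  assumes "test_fun f"
  obtains R :: real where "R > 0" "\<And>x. norm x > R \<Longrightarrow> f x = 0"
proof -
  obtain R where "\<forall>x. norm x > R \<longrightarrow> f x = 0" using assms by (auto simp: test_fun_iff)
  then show ?thesis by (intro that[of "max R 1"]) auto
qed

lemma pd_zero_outside:
  fixes f :: "'a::euclidean_space \<Rightarrow> 'b::real_normed_vector"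
  assumes "\<And>x. norm x > R \<Longrightarrow> f x = 0" "norm x > R"
  shows "pd b f x = 0"
proof (rule pd_eqI)
  have "open {x::'a. norm x > R}" by (intro open_Collect_less continuous_intros)
  then have "open ((\<lambda>t::real. x + t *\<^sub>R b) -` {x. norm x > R})"
    by (intro open_vimage continuous_intros)
  moreover have "((\<lambda>t::real. 0 :: 'b) has_vector_derivative 0) (at 0)" by simp
  ultimately show "((\<lambda>t. f (x + t *\<^sub>R b)) has_vector_derivative 0) (at 0)"
    using assms by (elim has_vector_derivative_transform_within_open) auto
qed

lemma test_fun_pd:
  fixes f :: "'a::euclidean_space \<Rightarrow> 'b::real_normed_vector"
  assumes "test_fun f" "b \<in> Basis"
  shows "test_fun (pd b f)"
  using assms pd_zero_outside[of _ f _ b] smooth_funD(3)[of f b] unfolding test_fun_iff by metis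

lemma test_fun_mult:
  fixes f g :: "'a::euclidean_space \<Rightarrow> real"
  assumes "test_fun f" "smooth_fun g"
  shows "test_fun (\<lambda>x. f x * g x)" "test_fun (\<lambda>x. g x * f x)"
  using assms smooth_fun_mult[of f g] smooth_fun_mult[of g f] unfolding test_fun_iff by fastforce+

lemma test_fun_add:
  fixes f g :: "'a::euclidean_space \<Rightarrow> real"
  assumes "test_fun f" "test_fun g"
  shows "test_fun (\<lambda>x. f x + g x)"
proof -
  obtain R S where "\<And>x. norm x > R \<Longrightarrow> f x = 0" "\<And>x. norm x > S \<Longrightarrow> g x = 0"
    using test_fun_support[OF assms(1)] test_fun_support[OF assms(2)] by metis
  then have "\<forall>x. norm x > max R S \<longrightarrow> f x + g x = 0" by simp
  then show ?thesis using assms smooth_fun_add[of f g] unfolding test_fun_iff by blast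
qed

lemma test_fun_bounded:
  fixes f :: "'a::euclidean_space \<Rightarrow> real"
  assumes "test_fun f"
  obtains B where "B > 0" "\<And>x. \<bar>f x\<bar> \<le> B"
proof -
  obtain R where R: "R > 0" "\<And>x. norm x > R \<Longrightarrow> f x = 0" using test_fun_support[OF assms] by metis
  have "compact (f ` cball 0 R)"
    using smooth_funD(1)[OF test_fun_smooth[OF assms]]
    by (intro compact_continuous_image) (auto intro: continuous_on_subset)
  then obtain B where "B > 0" "\<forall>y\<in>f ` cball 0 R. norm y \<le> B"
    using compact_imp_bounded bounded_pos by metis
  then have B: "B > 0" "\<And>x. norm x \<le> R \<Longrightarrow> \<bar>f x\<bar> \<le> B" by auto
  have "\<bar>f x\<bar> \<le> B" for x
    using B R by (cases "norm x \<le> R") (auto simp: not_le less_imp_le)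
  then show ?thesis using B(1) by (rule that[rotated])
qed

text \<open>The mean value bound is uniform in \<open>x\<close> and \<open>t\<close>, which makes it
  the dominating constant when a convolution is differentiated under the integral.\<close>

lemma test_fun_diff_quotient_le:
  fixes f :: "'a::euclidean_space \<Rightarrow> real"
  assumes f: "test_fun f" and b: "b \<in> Basis" and B: "\<And>x. \<bar>pd b f x\<bar> \<le> B"
  shows "\<bar>f (x + t *\<^sub>R b) - f x\<bar> \<le> B * \<bar>t\<bar>"
proof -
  have "\<And>s. ((\<lambda>t. f (x + t *\<^sub>R b)) has_real_derivative pd b f (x + s *\<^sub>R b)) (at s)"
    by (intro smooth_fun_real_deriv test_fun_smooth f b)
  then have "norm (f (x + t *\<^sub>R b) - f (x + 0 *\<^sub>R b)) \<le> B * norm (t - 0)"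
    by (intro field_differentiable_bound[where S = UNIV and f' = "\<lambda>s. pd b f (x + s *\<^sub>R b)"])
      (auto simp: B)
  then show ?thesis by simp
qed

text \<open>For fixed \<open>x\<close> the kernel of a convolution is thus a test function in
  \<open>y\<close>. This is what allows the weak equation to be tested with a reflected and
  translated mollifier.\<close>

lemma
  fixes f :: "'a::euclidean_space \<Rightarrow> real"
  shows smooth_fun_reflect: "smooth_fun f \<Longrightarrow> smooth_fun (\<lambda>y. f (x - y))"
    and pd_reflect: "smooth_fun f \<Longrightarrow> b \<in> Basis \<Longrightarrow> pd b (\<lambda>y. f (x - y)) y = - pd b f (x - y)"
    and test_fun_reflect: "test_fun f \<Longrightarrow> test_fun (\<lambda>y. f (x - y))"
proof -
  have deriv: "((\<lambda>t::real. g (x - (y + t *\<^sub>R b))) has_vector_derivative - pd b g (x - y)) (at 0)"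
    if "smooth_fun g" "b \<in> Basis" for g :: "'a \<Rightarrow> real" and b y
  proof -
    have "((\<lambda>t::real. g ((x - y) + t *\<^sub>R b)) has_real_derivative pd b g (x - y)) (at (- 0))"
      using smooth_fun_real_deriv[OF that, of "x - y" 0] by simp
    then have "((\<lambda>t::real. g ((x - y) + (- t) *\<^sub>R b)) has_real_derivative - pd b g (x - y)) (at 0)"
      by (subst (asm) DERIV_mirror)
    then show ?thesis
      by (simp add: has_real_derivative_iff_has_vector_derivative algebra_simps)
  qed
  show smooth: "smooth_fun (\<lambda>y. f (x - y))" if "smooth_fun f" for f :: "'a \<Rightarrow> real"
  proof (rule smooth_fun_algebra_closure)
    let ?A = "{\<lambda>y. g (x - y) |g. smooth_fun g}"
    show "(\<lambda>y. f (x - y)) \<in> algebra_closure ?A" using that by (blast intro: algebra_closure.base)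
    show "continuous_on UNIV h" if "h \<in> ?A" for h
      using that by (auto intro!: continuous_intros continuous_on_compose2[OF smooth_funD(1)])
    show "\<exists>g'\<in>algebra_closure ?A. \<forall>y. ((\<lambda>t::real. h (y + t *\<^sub>R b)) has_vector_derivative g' y) (at 0)"
      if "h \<in> ?A" "b \<in> Basis" for h and b :: 'a
    proof -
      obtain g where g: "h = (\<lambda>y. g (x - y))" "smooth_fun g" using \<open>h \<in> ?A\<close> by blast
      have "(\<lambda>y. pd b g (x - y)) \<in> algebra_closure ?A"
        using smooth_funD(3)[OF g(2) that(2)] by (blast intro: algebra_closure.base)
      then have "(\<lambda>y. (-1) * pd b g (x - y)) \<in> algebra_closure ?A"
        by (intro algebra_closure.mult algebra_closure.const)
      then show ?thesis
        using deriv[OF g(2) that(2)] by (intro bexI[of _ "\<lambda>y. (-1) * pd b g (x - y)"]) (auto simp: g(1))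
    qed
  qed
  show "pd b (\<lambda>y. f (x - y)) y = - pd b f (x - y)" if "smooth_fun f" "b \<in> Basis"
    by (intro pd_eqI deriv that)
  show "test_fun (\<lambda>y. f (x - y))" if tf: "test_fun f"
  proof -
    obtain R where R: "\<And>x. norm x > R \<Longrightarrow> f x = 0" using test_fun_support[OF tf] by blast
    have "f (x - y) = 0" if "norm y > R + norm x" for y
      using norm_triangle_ineq2[of y x] that by (intro R) (simp add: norm_minus_commute)
    then show ?thesis using tf smooth[of f] unfolding test_fun_iff by blast
  qed
qed

section \<open>Locally integrable weights and convolution\<close>

lemma L1_loc_measurable: "L1_loc w \<Longrightarrow> w \<in> borel_measurable borel"
  by (simp add: L1_loc_def)

lemma L1_loc_dominated:
  assumes w: "L1_loc w" and v: "v \<in> borel_measurable borel" and le: "\<And>x. \<bar>v x\<bar> \<le> B * \<bar>w x\<bar>"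
  shows "L1_loc v"
  unfolding L1_loc_def
proof (intro conjI allI impI)
  show "v \<in> borel_measurable lborel" using v by simp
  fix K :: "'a set" assume K: "compact K"
  then have [measurable]: "K \<in> sets borel" by (simp add: borel_compact)
  have "set_integrable lborel K w" using w K unfolding L1_loc_def by blast
  then have "integrable lborel (\<lambda>x. B * \<bar>indicator K x *\<^sub>R w x\<bar>)"
    unfolding set_integrable_def by (intro integrable_mult_right integrable_abs)
  then show "set_integrable lborel K v"
    unfolding set_integrable_def
  proof (rule Bochner_Integration.integrable_bound)
    show "(\<lambda>x. indicat_real K x *\<^sub>R v x) \<in> borel_measurable lborel" using v by measurable
    have "norm (indicat_real K x *\<^sub>R v x) \<le> norm (B * \<bar>indicat_real K x *\<^sub>R w x\<bar>)" for x
      using le[of x] abs_ge_self[of "B * \<bar>w x\<bar>"] by (auto simp: indicator_def)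
    then show "AE x in lborel. norm (indicat_real K x *\<^sub>R v x) \<le> norm (B * \<bar>indicat_real K x *\<^sub>R w x\<bar>)"
      by simp
  qed
qed

lemma L1_loc_const: "L1_loc (\<lambda>_. c)"
proof -
  have "emeasure lborel K < top" if "compact K" for K :: "'a set"
    using emeasure_bounded_finite[OF compact_imp_bounded[OF that]] by simp
  then show ?thesis unfolding L1_loc_def set_integrable_def
    by (auto intro!: integrable_real_indicator integrable_mult_left simp: borel_compact)
qed

lemma L1_loc_add:
  assumes "L1_loc v" "L1_loc w" shows "L1_loc (\<lambda>x. v x + w x)"
  using assms unfolding L1_loc_def by (auto intro!: set_integral_add)

lemma L1_loc_mult_bounded:
  assumes w: "L1_loc w" and v: "v \<in> borel_measurable borel" and le: "\<And>x. \<bar>v x\<bar> \<le> B"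
  shows "L1_loc (\<lambda>x. w x * v x)"
  using w
proof (rule L1_loc_dominated)
  show "(\<lambda>x. w x * v x) \<in> borel_measurable borel"
    using v L1_loc_measurable[OF w] by measurable
  show "\<bar>w x * v x\<bar> \<le> B * \<bar>w x\<bar>" for x
    using mult_right_mono[OF le abs_ge_zero, of x "w x"] by (simp add: abs_mult mult.commute)
qed

text \<open>The pointwise bound |w| <= w^2 + 1 takes the place of Cauchy-Schwarz on compact
  sets.\<close>

lemma L2_loc_imp_L1_loc:
  assumes "L2_loc w"
  shows "L1_loc w"
proof -
  have m: "w \<in> borel_measurable borel" using assms by (simp add: L2_loc_def)
  have "L1_loc (\<lambda>x. (w x)\<^sup>2)"
    using assms m unfolding L1_loc_def L2_loc_def by simp
  then have "L1_loc (\<lambda>x. (w x)\<^sup>2 + 1)" by (rule L1_loc_add[OF _ L1_loc_const])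
  then show ?thesis
  proof (rule L1_loc_dominated[OF _ m])
    show "\<bar>w x\<bar> \<le> 1 * \<bar>(w x)\<^sup>2 + 1\<bar>" for x
    proof -
      have "0 \<le> (\<bar>w x\<bar> - 1)\<^sup>2" by simp
      then have "2 * \<bar>w x\<bar> \<le> (w x)\<^sup>2 + 1" by (simp add: power2_eq_square algebra_simps)
      then show ?thesis by simp
    qed
  qed
qed

lemma L1_loc_set_integrable:
  assumes "L1_loc w" shows "integrable lborel (\<lambda>x. indicat_real (cball c R) x * \<bar>w x\<bar>)"
proof -
  have "set_integrable lborel (cball c R) w" using assms unfolding L1_loc_def by simp
  then have "integrable lborel (\<lambda>x. \<bar>indicator (cball c R) x *\<^sub>R w x\<bar>)"
    unfolding set_integrable_def by (rule integrable_abs)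
  then show ?thesis by (simp add: abs_mult)
qed

lemma L1_loc_integrable_mult:
  fixes w :: "'a::euclidean_space \<Rightarrow> real"
  assumes w: "L1_loc w" and g: "g \<in> borel_measurable borel"
    and B: "\<And>x. \<bar>g x\<bar> \<le> B" and R: "\<And>x. norm x > R \<Longrightarrow> g x = 0"
  shows "integrable lborel (\<lambda>x. w x * g x)"
proof (rule Bochner_Integration.integrable_bound)
  show "integrable lborel (\<lambda>x. B * (indicat_real (cball 0 R) x * \<bar>w x\<bar>))"
    by (intro integrable_mult_right L1_loc_set_integrable w)
  show "(\<lambda>x. w x * g x) \<in> borel_measurable lborel"
    using g L1_loc_measurable[OF w] by measurable
  have "\<bar>w x * g x\<bar> \<le> B * (indicat_real (cball 0 R) x * \<bar>w x\<bar>)" for x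
    using R[of x] mult_right_mono[OF B abs_ge_zero, of x "w x"]
    by (auto simp: indicator_def abs_mult mult.commute not_le)
  then show "AE x in lborel. norm (w x * g x) \<le> norm (B * (indicat_real (cball 0 R) x * \<bar>w x\<bar>))"
    by (auto intro: order_trans[OF _ abs_ge_self])
qed

text \<open>The dominating function is \<open>B\<close> times |w| on one fixed ball. Continuity and
  differentiability of convolutions and the limits in the quadratic forms all use dominated
  convergence in this shape.\<close>

lemma L1_loc_tendsto_integral:
  fixes w :: "'a::euclidean_space \<Rightarrow> real" and G :: "nat \<Rightarrow> 'a \<Rightarrow> real"
  assumes w: "L1_loc w" and G: "\<And>n. G n \<in> borel_measurable borel" and g: "g \<in> borel_measurable borel"
    and B: "\<And>n x. \<bar>G n x\<bar> \<le> B" and R: "\<And>n x. norm x > R \<Longrightarrow> G n x = 0"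
    and lim: "AE x in lborel. (\<lambda>n. G n x) \<longlonglongrightarrow> g x"
  shows "(\<lambda>n. \<integral>x. w x * G n x \<partial>lborel) \<longlonglongrightarrow> (\<integral>x. w x * g x \<partial>lborel)"
proof (rule integral_dominated_convergence)
  show "integrable lborel (\<lambda>x. B * (indicat_real (cball 0 R) x * \<bar>w x\<bar>))"
    by (intro integrable_mult_right L1_loc_set_integrable w)
  show "(\<lambda>x. w x * G n x) \<in> borel_measurable lborel" for n
    using G[of n] L1_loc_measurable[OF w] by measurable
  show "(\<lambda>x. w x * g x) \<in> borel_measurable lborel"
    using g L1_loc_measurable[OF w] by measurable
  show "AE x in lborel. (\<lambda>n. w x * G n x) \<longlonglongrightarrow> w x * g x"
    using lim by eventually_elim (auto intro: tendsto_intros)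
  have "\<bar>w x * G n x\<bar> \<le> B * (indicat_real (cball 0 R) x * \<bar>w x\<bar>)" for n x
    using R[of x n] mult_right_mono[OF B abs_ge_zero, of n x "w x"]
    by (auto simp: indicator_def abs_mult mult.commute not_le)
  then show "AE x in lborel. norm (w x * G n x) \<le> B * (indicat_real (cball 0 R) x * \<bar>w x\<bar>)" for n
    by simp
qed

lemma smooth_fun_measurable:
  fixes f :: "'a::euclidean_space \<Rightarrow> real"
  shows "smooth_fun f \<Longrightarrow> f \<in> borel_measurable borel"
  by (intro borel_measurable_continuous_onI smooth_funD(1))

lemma L1_loc_integrable_test_fun:
  fixes w g :: "'a::euclidean_space \<Rightarrow> real"
  assumes "L1_loc w" "test_fun g"
  shows "integrable lborel (\<lambda>x. w x * g x)"
proof -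
  obtain R where R: "\<And>x. norm x > R \<Longrightarrow> g x = 0" using test_fun_support[OF assms(2)] by blast
  obtain B where B: "\<And>x. \<bar>g x\<bar> \<le> B" using test_fun_bounded[OF assms(2)] by blast
  show ?thesis
    by (rule L1_loc_integrable_mult[OF assms(1) smooth_fun_measurable B R])
      (auto intro: test_fun_smooth assms)
qed

lemma integrable_test_fun:
  fixes g :: "'a::euclidean_space \<Rightarrow> real"
  shows "test_fun g \<Longrightarrow> integrable lborel g"
  using L1_loc_integrable_test_fun[OF L1_loc_const[of 1], of g] by simp

section \<open>Convolution with a test function\<close>

definition convolution :: "('a::euclidean_space \<Rightarrow> real) \<Rightarrow> ('a \<Rightarrow> real) \<Rightarrow> 'a \<Rightarrow> real" where
  "convolution w g x = (\<integral>y. w y * g (x - y) \<partial>lborel)"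

lemma convolution_integrable:
  fixes w g :: "'a::euclidean_space \<Rightarrow> real"
  shows "L1_loc w \<Longrightarrow> test_fun g \<Longrightarrow> integrable lborel (\<lambda>y. w y * g (x - y))"
  by (intro L1_loc_integrable_test_fun test_fun_reflect)

lemma convolution_continuous:
  fixes w g :: "'a::euclidean_space \<Rightarrow> real"
  assumes w: "L1_loc w" and g: "test_fun g"
  shows "continuous_on UNIV (convolution w g)"
proof -
  have "isCont (convolution w g) x" for x
    unfolding continuous_at_sequentially comp_def
  proof (intro allI impI)
    fix X :: "nat \<Rightarrow> 'a" assume X: "X \<longlonglongrightarrow> x"
    then have "bounded (range X)" by (rule convergent_imp_bounded)
    then obtain H where H: "\<And>n. norm (X n) \<le> H" by (auto simp: bounded_iff)
    obtain R where R: "\<And>x. norm x > R \<Longrightarrow> g x = 0" using test_fun_support[OF g] by blast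
    obtain B where B: "\<And>x. \<bar>g x\<bar> \<le> B" using test_fun_bounded[OF g] by blast
    have gc: "continuous_on UNIV g" by (intro smooth_funD(1) test_fun_smooth g)
    show "(\<lambda>n. convolution w g (X n)) \<longlonglongrightarrow> convolution w g x"
      unfolding convolution_def using w
    proof (rule L1_loc_tendsto_integral)
      show "(\<lambda>y. g (X n - y)) \<in> borel_measurable borel" "(\<lambda>y. g (x - y)) \<in> borel_measurable borel" for n
        by (intro smooth_fun_measurable smooth_fun_reflect test_fun_smooth g)+
      show "\<bar>g (X n - y)\<bar> \<le> B" for n y by (rule B)
      show "g (X n - y) = 0" if "norm y > R + H" for n y
        using norm_triangle_ineq2[of y "X n"] H[of n] that by (intro R) (simp add: norm_minus_commute)
      have "(\<lambda>n. g (X n - y)) \<longlonglongrightarrow> g (x - y)" for y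
        by (rule continuous_on_tendsto_compose[OF gc]) (auto intro!: tendsto_intros X)
      then show "AE y in lborel. (\<lambda>n. g (X n - y)) \<longlonglongrightarrow> g (x - y)" by simp
    qed
  qed
  then show ?thesis by (simp add: continuous_on_eq_continuous_at)
qed

text \<open>The smooth factor carries the variable, so the derivative falls on \<open>g\<close>, and
  local integrability of \<open>w\<close> suffices. Dominated convergence is sequential, hence the
  difference quotients are taken along arbitrary null sequences \<open>h\<close>.\<close>

lemma convolution_deriv:
  fixes w g :: "'a::euclidean_space \<Rightarrow> real"
  assumes w: "L1_loc w" and g: "test_fun g" and b: "b \<in> Basis"
  shows "((\<lambda>t::real. convolution w g (x + t *\<^sub>R b)) has_vector_derivative convolution w (pd b g) x) (at 0)"
proof -
  have gs: "smooth_fun g" by (rule test_fun_smooth[OF g])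
  obtain R where R: "\<And>x. norm x > R \<Longrightarrow> g x = 0" using test_fun_support[OF g] by blast
  obtain B where B: "\<And>x. \<bar>pd b g x\<bar> \<le> B" using test_fun_bounded[OF test_fun_pd[OF g b]] by blast
  have "(\<lambda>n. (convolution w g (x + h n *\<^sub>R b) - convolution w g x) / h n) \<longlonglongrightarrow> convolution w (pd b g) x"
    if h: "\<And>n. h n \<noteq> 0" "h \<longlonglongrightarrow> 0" for h :: "nat \<Rightarrow> real"
  proof -
    have "bounded (range h)" by (rule convergent_imp_bounded[OF h(2)])
    then obtain H where H: "\<And>n. \<bar>h n\<bar> \<le> H" by (auto simp: bounded_iff)
    have eq: "(convolution w g (x + h n *\<^sub>R b) - convolution w g x) / h n
        = (\<integral>y. w y * ((g (x + h n *\<^sub>R b - y) - g (x - y)) / h n) \<partial>lborel)" for n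
    proof -
      have "convolution w g (x + h n *\<^sub>R b) - convolution w g x
        = (\<integral>y. w y * g (x + h n *\<^sub>R b - y) - w y * g (x - y) \<partial>lborel)"
        unfolding convolution_def
        by (intro Bochner_Integration.integral_diff[symmetric] convolution_integrable w g)
      also have "\<dots> / h n = (\<integral>y. (w y * g (x + h n *\<^sub>R b - y) - w y * g (x - y)) / h n \<partial>lborel)"
        by simp
      finally show ?thesis by (simp add: algebra_simps diff_divide_distrib)
    qed
    have "(\<lambda>n. \<integral>y. w y * ((g (x + h n *\<^sub>R b - y) - g (x - y)) / h n) \<partial>lborel)
        \<longlonglongrightarrow> (\<integral>y. w y * pd b g (x - y) \<partial>lborel)"
      using w
    proof (rule L1_loc_tendsto_integral)
      have [measurable]: "(\<lambda>y. g (z - y)) \<in> borel_measurable borel" for z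
        by (intro smooth_fun_measurable smooth_fun_reflect gs)
      show "(\<lambda>y. (g (x + h n *\<^sub>R b - y) - g (x - y)) / h n) \<in> borel_measurable borel" for n
        by measurable
      show "(\<lambda>y. pd b g (x - y)) \<in> borel_measurable borel"
        by (intro smooth_fun_measurable smooth_fun_reflect smooth_funD(3) gs b)
      show "\<bar>(g (x + h n *\<^sub>R b - y) - g (x - y)) / h n\<bar> \<le> B" for n y
        using test_fun_diff_quotient_le[OF g b B, of "x - y" "h n"] h(1)[of n]
        by (simp add: abs_divide divide_le_eq algebra_simps)
      \<comment> \<open>One ball contains the supports of all the difference quotients:
        \<open>H\<close> bounds the increments and \<open>b\<close> has norm 1.\<close>
      show "(g (x + h n *\<^sub>R b - y) - g (x - y)) / h n = 0" if y: "norm y > R + norm x + H" for n y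
      proof -
        have "norm y \<le> norm (x - y) + norm x" using norm_triangle_ineq2[of y x] by (simp add: norm_minus_commute)
        moreover have "norm y \<le> norm (x + h n *\<^sub>R b - y) + norm x + H"
          using norm_triangle_ineq2[of y "x + h n *\<^sub>R b"] norm_triangle_ineq[of x "h n *\<^sub>R b"] H[of n] b
          by (simp add: norm_minus_commute)
        moreover have "0 \<le> H" using H[of 0] by simp
        ultimately have "R < norm (x - y)" "R < norm (x + h n *\<^sub>R b - y)" using y by linarith+
        then show ?thesis by (simp add: R)
      qed
      have "(\<lambda>n. (g (x + h n *\<^sub>R b - y) - g (x - y)) / h n) \<longlonglongrightarrow> pd b g (x - y)" for y
      proof -
        have "((\<lambda>t. (g ((x - y) + t *\<^sub>R b) - g (x - y)) / t) \<longlongrightarrow> pd b g (x - y)) (at 0)"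
          using smooth_fun_real_deriv[OF gs b, of "x - y" 0] by (simp add: DERIV_def)
        then have "((\<lambda>t. (g ((x - y) + t *\<^sub>R b) - g (x - y)) / t) \<circ> h) \<longlonglongrightarrow> pd b g (x - y)"
          using h unfolding tendsto_at_iff_sequentially by blast
        then show ?thesis by (simp add: o_def algebra_simps)
      qed
      then show "AE y in lborel. (\<lambda>n. (g (x + h n *\<^sub>R b - y) - g (x - y)) / h n) \<longlonglongrightarrow> pd b g (x - y)"
        by simp
    qed
    then show ?thesis unfolding eq by (simp only: convolution_def)
  qed
  then have "((\<lambda>t. (convolution w g (x + t *\<^sub>R b) - convolution w g x) / t) \<longlongrightarrow> convolution w (pd b g) x) (at 0)"
    unfolding tendsto_at_iff_sequentially by (auto simp: o_def)
  then have "((\<lambda>t. convolution w g (x + t *\<^sub>R b)) has_real_derivative convolution w (pd b g) x) (at 0)"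
    by (simp add: DERIV_def)
  then show ?thesis by (simp add: has_real_derivative_iff_has_vector_derivative)
qed

lemma pd_convolution:
  fixes w g :: "'a::euclidean_space \<Rightarrow> real"
  assumes "L1_loc w" "test_fun g" "b \<in> Basis"
  shows "pd b (convolution w g) = convolution w (pd b g)"
  by (intro ext pd_eqI convolution_deriv assms)

text \<open>The convolutions of \<open>w\<close> with all test functions form a set stable under
  partial derivatives, which is the witness required.\<close>

lemma smooth_fun_convolution:
  fixes w g :: "'a::euclidean_space \<Rightarrow> real"
  assumes w: "L1_loc w" and g: "test_fun g"
  shows "smooth_fun (convolution w g)"
  unfolding smooth_fun_def
proof (intro exI conjI ballI)
  let ?S = "{convolution w g |g. test_fun g}"
  show "convolution w g \<in> ?S" using g by blast
  show "continuous_on UNIV h" if "h \<in> ?S" for h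
    using that convolution_continuous[OF w] by blast
  show "\<exists>g'\<in>?S. \<forall>x. ((\<lambda>t::real. h (x + t *\<^sub>R b)) has_vector_derivative g' x) (at 0)"
    if "h \<in> ?S" "b \<in> Basis" for h b
    using that convolution_deriv[OF w] test_fun_pd by blast
qed

section \<open>Invariance of Lebesgue measure under reflection and translation\<close>

lemma lborel_distr_reflect:
  fixes x :: "'a::euclidean_space"
  shows "distr lborel borel (\<lambda>y. x - y) = lborel"
  by (subst (2) lborel_affine[of "-1" x]) (auto simp: density_1)

lemma
  fixes f :: "'a::euclidean_space \<Rightarrow> real"
  assumes [measurable]: "f \<in> borel_measurable borel"
  shows integral_lborel_reflect: "(\<integral>y. f (x - y) \<partial>lborel) = (\<integral>y. f y \<partial>lborel)"
    and integral_lborel_translate: "(\<integral>y. f (x + y) \<partial>lborel) = (\<integral>y. f y \<partial>lborel)"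
    and integrable_lborel_reflect: "integrable lborel (\<lambda>y. f (x - y)) \<longleftrightarrow> integrable lborel f"
    and integrable_lborel_translate: "integrable lborel (\<lambda>y. f (x + y)) \<longleftrightarrow> integrable lborel f"
  using integral_distr[of "\<lambda>y. x - y" lborel borel f] integral_distr[of "(+) x" lborel borel f]
    integrable_distr_eq[of "\<lambda>y. x - y" lborel borel f] integrable_distr_eq[of "(+) x" lborel borel f]
  by (simp_all add: lborel_distr_reflect lborel_distr_plus)

text \<open>The total integral of a test function is translation invariant, so its derivative along
  any direction vanishes; this replaces Fubini in the divergence theorem.\<close>
lemma integral_pd_eq_0:
  fixes g :: "'a::euclidean_space \<Rightarrow> real"
  assumes g: "test_fun g" and b: "b \<in> Basis"
  shows "(\<integral>x. pd b g x \<partial>lborel) = 0"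
proof -
  have gs: "smooth_fun g" by (rule test_fun_smooth[OF g])
  have const: "convolution (\<lambda>_. 1) g = (\<lambda>x. \<integral>y. g y \<partial>lborel)"
    by (auto simp: convolution_def integral_lborel_reflect smooth_fun_measurable gs)
  have "(\<integral>x. pd b g x \<partial>lborel) = convolution (\<lambda>_. 1) (pd b g) 0"
    unfolding convolution_def using smooth_fun_measurable[OF smooth_funD(3)[OF gs b]]
      integral_lborel_reflect[of "pd b g" 0] by simp
  also have "\<dots> = pd b (convolution (\<lambda>_. 1) g) 0"
    by (simp add: pd_convolution[OF L1_loc_const g b])
  also have "\<dots> = 0" by (simp add: const pd_const)
  finally show ?thesis .
qed

section \<open>Continuity of translation and mollification in the mean\<close>

text \<open>The modulus of continuity of translation in the L1 norm.\<close>

definition translation_error :: "('a::euclidean_space \<Rightarrow> real) \<Rightarrow> 'a \<Rightarrow> real" where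
  "translation_error h y = (\<integral>x. \<bar>h (y + x) - h x\<bar> \<partial>lborel)"

lemma integrable_translate:
  fixes h :: "'a::euclidean_space \<Rightarrow> real"
  assumes "integrable lborel h"
  shows "integrable lborel (\<lambda>x. h (y + x))"
  using assms integrable_lborel_translate[of h y] borel_measurable_integrable[OF assms] by simp

lemma integral_abs_translate:
  fixes h :: "'a::euclidean_space \<Rightarrow> real"
  assumes "integrable lborel h"
  shows "(\<integral>x. \<bar>h (y + x)\<bar> \<partial>lborel) = (\<integral>x. \<bar>h x\<bar> \<partial>lborel)"
  using integral_lborel_translate[of "\<lambda>x. \<bar>h x\<bar>" y] borel_measurable_integrable[OF assms] by simp

lemma translation_error_add_le:
  assumes "integrable lborel f" "integrable lborel g"
  shows "translation_error (\<lambda>x. f x + g x) y \<le> translation_error f y + translation_error g y"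
proof -
  note [simp] = assms integrable_translate[OF assms(1)] integrable_translate[OF assms(2)]
  have "translation_error (\<lambda>x. f x + g x) y
      \<le> (\<integral>x. \<bar>f (y + x) - f x\<bar> + \<bar>g (y + x) - g x\<bar> \<partial>lborel)"
    unfolding translation_error_def by (intro integral_mono) auto
  also have "\<dots> = translation_error f y + translation_error g y"
    unfolding translation_error_def by (intro Bochner_Integration.integral_add) auto
  finally show ?thesis .
qed

lemma translation_error_le_norm:
  assumes "integrable lborel h"
  shows "translation_error h y \<le> 2 * (\<integral>x. \<bar>h x\<bar> \<partial>lborel)"
proof -
  note [simp] = assms integrable_translate[OF assms]
  have "translation_error h y \<le> (\<integral>x. \<bar>h (y + x)\<bar> + \<bar>h x\<bar> \<partial>lborel)"
    unfolding translation_error_def by (intro integral_mono) auto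
  also have "\<dots> = (\<integral>x. \<bar>h (y + x)\<bar> \<partial>lborel) + (\<integral>x. \<bar>h x\<bar> \<partial>lborel)"
    by (intro Bochner_Integration.integral_add) auto
  finally show ?thesis by (simp add: integral_abs_translate)
qed

lemma translation_error_nonneg: "translation_error h y \<ge> 0"
  unfolding translation_error_def by simp

text \<open>Translation is an L1 isometry, so functions with vanishing translation error form an
  L1-closed set. The remainder \<open>h - g\<close> costs twice its norm, which is why the
  approximation is taken within e/4.\<close>

lemma tendsto_translation_error_approx:
  assumes h: "integrable lborel h"
    and approx: "\<And>e. e > 0 \<Longrightarrow> \<exists>g. integrable lborel g \<and> (translation_error g \<longlongrightarrow> 0) (at 0)
      \<and> (\<integral>x. \<bar>h x - g x\<bar> \<partial>lborel) < e"
  shows "(translation_error h \<longlongrightarrow> 0) (at 0)"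
proof (rule tendstoI)
  fix e :: real assume "e > 0"
  then obtain g where g: "integrable lborel g" "(translation_error g \<longlongrightarrow> 0) (at 0)"
      "(\<integral>x. \<bar>h x - g x\<bar> \<partial>lborel) < e / 4"
    using approx[of "e / 4"] by auto
  have "eventually (\<lambda>y. dist (translation_error g y) 0 < e / 2) (at 0)"
    using \<open>e > 0\<close> by (intro tendstoD g(2)) simp
  then show "eventually (\<lambda>y. dist (translation_error h y) 0 < e) (at 0)"
  proof eventually_elim
    case (elim y)
    have "translation_error (\<lambda>x. g x + (h x - g x)) y
        \<le> translation_error g y + translation_error (\<lambda>x. h x - g x) y"
      by (intro translation_error_add_le Bochner_Integration.integrable_diff h g(1))
    moreover have "translation_error (\<lambda>x. h x - g x) y \<le> 2 * (\<integral>x. \<bar>h x - g x\<bar> \<partial>lborel)"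
      by (intro translation_error_le_norm Bochner_Integration.integrable_diff h g(1))
    ultimately show ?case
      using elim g(3) translation_error_nonneg[of g y] translation_error_nonneg[of h y] by simp
  qed
qed

text \<open>For indicators |a - b| = a + b - 2ab, so by translation invariance only the overlap
  integral needs a limit. Its integrand converges everywhere: on \<open>A\<close> by openness, off
  \<open>A\<close> because the factor is 0. The translated indicators alone may fail to converge on
  the boundary, which can have positive measure.\<close>

lemma tendsto_translation_error_open:
  assumes A: "open A" "emeasure lborel A < \<infinity>"
  shows "(translation_error (indicator A) \<longlongrightarrow> 0) (at 0)"
  unfolding tendsto_at_iff_sequentially
proof (intro allI impI)
  fix Y :: "nat \<Rightarrow> 'a" assume Y: "Y \<longlonglongrightarrow> 0"
  let ?I = "indicat_real A"
  have [measurable]: "A \<in> sets borel" using A by simp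
  have I: "integrable lborel ?I" using A by simp
  have IY: "integrable lborel (\<lambda>x. ?I (Y n + x))" for n by (rule integrable_translate[OF I])
  have prod: "integrable lborel (\<lambda>x. ?I (Y n + x) * ?I x)" for n
    by (rule Bochner_Integration.integrable_bound[OF I]) (auto simp: indicator_def)
  have eq: "translation_error ?I (Y n) = 2 * (\<integral>x. ?I x \<partial>lborel) - 2 * (\<integral>x. ?I (Y n + x) * ?I x \<partial>lborel)" for n
  proof -
    have "translation_error ?I (Y n) = (\<integral>x. ?I (Y n + x) + ?I x - 2 * (?I (Y n + x) * ?I x) \<partial>lborel)"
      unfolding translation_error_def by (rule Bochner_Integration.integral_cong) (auto simp: indicator_def)
    also have "\<dots> = (\<integral>x. ?I (Y n + x) \<partial>lborel) + (\<integral>x. ?I x \<partial>lborel) - 2 * (\<integral>x. ?I (Y n + x) * ?I x \<partial>lborel)"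
      using I IY[of n] prod[of n] by simp
    also have "(\<integral>x. ?I (Y n + x) \<partial>lborel) = (\<integral>x. ?I x \<partial>lborel)"
      by (rule integral_lborel_translate) measurable
    finally show ?thesis by simp
  qed
  have "(\<lambda>n. \<integral>x. ?I (Y n + x) * ?I x \<partial>lborel) \<longlonglongrightarrow> (\<integral>x. ?I x \<partial>lborel)"
  proof (rule integral_dominated_convergence[OF _ _ I])
    have "(\<lambda>n. ?I (Y n + x) * ?I x) \<longlonglongrightarrow> ?I x" for x
    proof (cases "x \<in> A")
      case True
      have "(\<lambda>n. Y n + x) \<longlonglongrightarrow> x" using tendsto_add[OF Y tendsto_const[of x]] by simp
      then have "eventually (\<lambda>n. Y n + x \<in> A) sequentially"
        using A(1) True by (rule topological_tendstoD)
      then show ?thesis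
        using True by (intro tendsto_eventually) (auto elim!: eventually_mono)
    qed simp
    then show "AE x in lborel. (\<lambda>n. ?I (Y n + x) * ?I x) \<longlonglongrightarrow> ?I x" by simp
  qed (auto simp: indicator_def)
  then have "(\<lambda>n. 2 * (\<integral>x. ?I x \<partial>lborel) - 2 * (\<integral>x. ?I (Y n + x) * ?I x \<partial>lborel)) \<longlonglongrightarrow>
      2 * (\<integral>x. ?I x \<partial>lborel) - 2 * (\<integral>x. ?I x \<partial>lborel)"
    by (intro tendsto_intros)
  then show "(translation_error ?I \<circ> Y) \<longlonglongrightarrow> 0" by (simp add: o_def eq)
qed

text \<open>For an open set the translated indicators converge pointwise on the set itself, and outer
  regularity passes from open to Borel sets.\<close>
lemma tendsto_translation_error:
  fixes h :: "'a::euclidean_space \<Rightarrow> real"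
  assumes "integrable lborel h"
  shows "(translation_error h \<longlongrightarrow> 0) (at 0)"
  using assms
proof (induction h rule: integrable_induct)
  case (base A c)
  have [measurable]: "A \<in> sets borel" using base by simp
  have I: "integrable lborel (indicat_real A)" using base by simp
  have "(translation_error (indicat_real A) \<longlongrightarrow> 0) (at 0)"
  proof (rule tendsto_translation_error_approx[OF I])
    fix e :: real assume "e > 0"
    then obtain U where U: "open U" "A \<subseteq> U" "emeasure lborel (U - A) < e"
      using outer_regular_lborel[of A e] by auto
    have [measurable]: "U \<in> sets borel" using U by simp
    have "emeasure lborel U \<le> emeasure lborel A + emeasure lborel (U - A)"
      using emeasure_subadditive[of A lborel "U - A"] U(2) by (simp add: Un_absorb1)
    also have "\<dots> < \<infinity>" using base(2) U(3) by (auto simp: less_top[symmetric] top_unique)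
    finally have fin: "emeasure lborel U < \<infinity>" .
    have "(\<integral>x. \<bar>indicat_real A x - indicat_real U x\<bar> \<partial>lborel) = (\<integral>x. indicat_real (U - A) x \<partial>lborel)"
      using U(2) by (intro Bochner_Integration.integral_cong) (auto simp: indicator_def)
    also have "\<dots> = measure lborel (U - A)" by simp
    also have "\<dots> < e" using U(3) \<open>e > 0\<close>
      unfolding measure_def by (subst enn2real_less_iff) (auto simp: less_top[symmetric] top_unique)
    finally have "(\<integral>x. \<bar>indicat_real A x - indicat_real U x\<bar> \<partial>lborel) < e" .
    then show "\<exists>g. integrable lborel g \<and> (translation_error g \<longlongrightarrow> 0) (at 0)
      \<and> (\<integral>x. \<bar>indicat_real A x - g x\<bar> \<partial>lborel) < e"
      using tendsto_translation_error_open[OF U(1) fin] fin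
      by (intro exI[of _ "indicat_real U"]) auto
  qed
  then have "((\<lambda>y. \<bar>c\<bar> * translation_error (indicat_real A) y) \<longlongrightarrow> \<bar>c\<bar> * 0) (at 0)"
    by (intro tendsto_intros)
  moreover have "\<bar>c\<bar> * translation_error (indicat_real A) y = translation_error (\<lambda>x. indicat_real A x *\<^sub>R c) y" for y
    unfolding translation_error_def
    by (subst integral_mult_right_zero[symmetric])
      (auto intro!: Bochner_Integration.integral_cong simp: abs_mult[symmetric] algebra_simps)
  ultimately show ?case by simp
next
  case (add f g)
  have "((\<lambda>y. translation_error f y + translation_error g y) \<longlongrightarrow> 0 + 0) (at 0)"
    using add by (intro tendsto_intros)
  then show ?case
    using translation_error_add_le[OF add.hyps(1,2)]
    by - (rule Lim_null_comparison[of _ "\<lambda>y. translation_error f y + translation_error g y"],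
        simp_all add: translation_error_nonneg)
next
  case (lim f s)
  have [measurable]: "f \<in> borel_measurable lborel" "\<And>i. s i \<in> borel_measurable lborel"
    using lim.hyps by auto
  have "(\<lambda>i. \<integral>x. \<bar>f x - s i x\<bar> \<partial>lborel) \<longlonglongrightarrow> (\<integral>x. 0 \<partial>(lborel :: 'a measure))"
  proof (rule integral_dominated_convergence)
    \<comment> \<open>The induction rule supplies simple functions bounded by twice |f|, so the
      difference is at most three times |f|.\<close>
    show "integrable lborel (\<lambda>x. 3 * \<bar>f x\<bar>)" using lim.hyps by simp
    have "(\<lambda>i. \<bar>f x - s i x\<bar>) \<longlonglongrightarrow> \<bar>f x - f x\<bar>" for x
      using lim.hyps by (intro tendsto_intros) simp
    then show "AE x in lborel. (\<lambda>i. \<bar>f x - s i x\<bar>) \<longlonglongrightarrow> 0" by simp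
    have "\<bar>f x - s i x\<bar> \<le> 3 * \<bar>f x\<bar>" for i x
      using lim.hyps(3)[of x i] by simp
    then show "AE x in lborel. norm \<bar>f x - s i x\<bar> \<le> 3 * \<bar>f x\<bar>" for i by simp
  qed measurable
  then have lim0: "(\<lambda>i. \<integral>x. \<bar>f x - s i x\<bar> \<partial>lborel) \<longlonglongrightarrow> 0" by simp
  show ?case
  proof (rule tendsto_translation_error_approx)
    fix e :: real assume "e > 0"
    then have "eventually (\<lambda>i. (\<integral>x. \<bar>f x - s i x\<bar> \<partial>lborel) < e) sequentially"
      by (rule order_tendstoD(2)[OF lim0])
    then obtain i where "(\<integral>x. \<bar>f x - s i x\<bar> \<partial>lborel) < e"
      by (auto simp: eventually_sequentially)
    then show "\<exists>g. integrable lborel g \<and> (translation_error g \<longlongrightarrow> 0) (at 0) \<and> (\<integral>x. \<bar>f x - g x\<bar> \<partial>lborel) < e"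
      using lim.hyps(1) lim.IH by blast
  qed (use lim.hyps in auto)
qed

section \<open>L1 convergence of mollifications\<close>

lemma integrable_imp_L1_loc:
  assumes "integrable lborel h" shows "L1_loc h"
  using integrable_mult_indicator[OF _ assms] borel_measurable_integrable[OF assms]
  unfolding L1_loc_def set_integrable_def by (simp add: borel_compact)

text \<open>Minkowski's integral inequality: the mollification error is an average, with density
  \<eta>, of translation errors. Tonelli is applied to nonnegative integrals because integrability
  of the difference is itself part of the conclusion.\<close>

lemma convolution_error:
  fixes h \<eta> :: "'a::euclidean_space \<Rightarrow> real"
  assumes h: "integrable lborel h" and \<eta>: "test_fun \<eta>" and pos: "\<And>y. 0 \<le> \<eta> y"
    and one: "(\<integral>y. \<eta> y \<partial>lborel) = 1"
    and e: "e \<ge> 0" "\<And>y. \<eta> y \<noteq> 0 \<Longrightarrow> translation_error h (- y) \<le> e"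
  shows "integrable lborel (\<lambda>x. convolution h \<eta> x - h x)"
    and "(\<integral>x. \<bar>convolution h \<eta> x - h x\<bar> \<partial>lborel) \<le> e"
proof -
  have [measurable]: "h \<in> borel_measurable borel" using borel_measurable_integrable[OF h] by simp
  have \<eta>s: "smooth_fun \<eta>" by (rule test_fun_smooth[OF \<eta>])
  have [measurable]: "\<eta> \<in> borel_measurable borel" by (rule smooth_fun_measurable[OF \<eta>s])
  have L1: "L1_loc h" by (rule integrable_imp_L1_loc[OF h])
  have [measurable]: "convolution h \<eta> \<in> borel_measurable borel"
    by (intro borel_measurable_continuous_onI convolution_continuous L1 \<eta>)
  have ptwise: "ennreal \<bar>convolution h \<eta> x - h x\<bar> \<le> (\<integral>\<^sup>+y. ennreal (\<bar>h (x - y) - h x\<bar> * \<eta> y) \<partial>lborel)" for x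
  proof -
    have m: "(\<lambda>y. h y * \<eta> (x - y)) \<in> borel_measurable borel" by measurable
    have "convolution h \<eta> x = (\<integral>y. h (x - y) * \<eta> y \<partial>lborel)"
      unfolding convolution_def using integral_lborel_reflect[OF m, of x] by simp
    moreover have int: "integrable lborel (\<lambda>y. h (x - y) * \<eta> y)"
      using convolution_integrable[OF L1 \<eta>, of x] integrable_lborel_reflect[OF m, of x] by simp
    moreover have int2: "integrable lborel (\<lambda>y. h x * \<eta> y)"
      using integrable_test_fun[OF \<eta>] by simp
    moreover have "h x = (\<integral>y. h x * \<eta> y \<partial>lborel)" using one by simp
    ultimately have "convolution h \<eta> x - h x = (\<integral>y. h (x - y) * \<eta> y - h x * \<eta> y \<partial>lborel)"
      by (simp add: Bochner_Integration.integral_diff)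
    also have "\<dots> = (\<integral>y. (h (x - y) - h x) * \<eta> y \<partial>lborel)" by (simp add: algebra_simps)
    finally have eq: "convolution h \<eta> x - h x = (\<integral>y. (h (x - y) - h x) * \<eta> y \<partial>lborel)" .
    have "integrable lborel (\<lambda>y. (h (x - y) - h x) * \<eta> y)"
      using Bochner_Integration.integrable_diff[OF int int2] by (simp add: algebra_simps)
    from integral_norm_bound_ennreal[OF this] show ?thesis
      using pos by (simp add: eq abs_mult)
  qed
  have shift: "(\<integral>\<^sup>+x. ennreal \<bar>h (x - y) - h x\<bar> \<partial>lborel) = ennreal (translation_error h (- y))" for y
    unfolding translation_error_def using h integrable_translate[OF h, of "- y"]
    by (subst nn_integral_eq_integral[symmetric]) (auto simp: algebra_simps)
  have "(\<integral>\<^sup>+x. ennreal \<bar>convolution h \<eta> x - h x\<bar> \<partial>lborel)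
      \<le> (\<integral>\<^sup>+x. (\<integral>\<^sup>+y. ennreal (\<bar>h (x - y) - h x\<bar> * \<eta> y) \<partial>lborel) \<partial>lborel)"
    by (intro nn_integral_mono ptwise)
  also have "\<dots> = (\<integral>\<^sup>+y. (\<integral>\<^sup>+x. ennreal (\<bar>h (x - y) - h x\<bar> * \<eta> y) \<partial>lborel) \<partial>lborel)"
    by (rule lborel_pair.Fubini'[symmetric]) measurable
  also have "\<dots> = (\<integral>\<^sup>+y. ennreal (translation_error h (- y)) * ennreal (\<eta> y) \<partial>lborel)"
    using pos by (simp add: ennreal_mult nn_integral_multc shift)
  also have "\<dots> \<le> (\<integral>\<^sup>+y. ennreal e * ennreal (\<eta> y) \<partial>lborel)"
  proof (rule nn_integral_mono)
    show "ennreal (translation_error h (- y)) * ennreal (\<eta> y) \<le> ennreal e * ennreal (\<eta> y)" for y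
      using e(2)[of y] by (cases "\<eta> y = 0") (auto intro!: mult_right_mono ennreal_leI)
  qed
  also have "\<dots> = ennreal e * (\<integral>\<^sup>+y. ennreal (\<eta> y) \<partial>lborel)"
    by (rule nn_integral_cmult) measurable
  also have "(\<integral>\<^sup>+y. ennreal (\<eta> y) \<partial>lborel) = 1"
    using nn_integral_eq_integral[OF integrable_test_fun[OF \<eta>]] pos one by simp
  finally have bound: "(\<integral>\<^sup>+x. ennreal \<bar>convolution h \<eta> x - h x\<bar> \<partial>lborel) \<le> ennreal e" by simp
  show int: "integrable lborel (\<lambda>x. convolution h \<eta> x - h x)"
  proof (rule integrableI_bounded)
    show "(\<integral>\<^sup>+x. ennreal (norm (convolution h \<eta> x - h x)) \<partial>lborel) < \<infinity>"
      using le_less_trans[OF bound] by simp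
  qed measurable
  show "(\<integral>x. \<bar>convolution h \<eta> x - h x\<bar> \<partial>lborel) \<le> e"
    using bound e(1) nn_integral_eq_integral[OF integrable_abs[OF int]] by simp
qed

lemma tendsto_convolution_L1:
  fixes w :: "'a::euclidean_space \<Rightarrow> real" and \<eta> :: "nat \<Rightarrow> 'a \<Rightarrow> real"
  assumes w: "L1_loc w" and \<eta>: "\<And>n. test_fun (\<eta> n)" and pos: "\<And>n y. 0 \<le> \<eta> n y"
    and one: "\<And>n. (\<integral>y. \<eta> n y \<partial>lborel) = 1"
    and supp: "\<And>n y. norm y > r n \<Longrightarrow> \<eta> n y = 0" and r: "r \<longlonglongrightarrow> 0"
  shows "integrable lborel (\<lambda>x. indicat_real (cball 0 R) x * (convolution w (\<eta> n) x - w x))" (is "?I n")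
    and "(\<lambda>n. \<integral>x. indicat_real (cball 0 R) x * \<bar>convolution w (\<eta> n) x - w x\<bar> \<partial>lborel) \<longlonglongrightarrow> 0"
proof -
  have "bounded (range r)" by (rule convergent_imp_bounded[OF r])
  then obtain H where H: "\<And>n. \<bar>r n\<bar> \<le> H" by (auto simp: bounded_iff)
  \<comment> \<open>On the ball of radius \<open>R\<close> the convolutions see \<open>w\<close>
    only within radius \<open>R + H\<close>, since \<open>H\<close> bounds all the support radii.
    Truncating there reduces the local statement to an integrable function.\<close>
  define h where "h x = indicat_real (cball 0 (R + H)) x *\<^sub>R w x" for x
  have h: "integrable lborel h"
    using w unfolding L1_loc_def h_def set_integrable_def by auto
  have eq: "convolution w (\<eta> n) x = convolution h (\<eta> n) x" "w x = h x" if "x \<in> cball 0 R" for n x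
  proof -
    have "w y * \<eta> n (x - y) = h y * \<eta> n (x - y)" for y
    proof (cases "norm y \<le> R + H")
      case False
      then have "norm (x - y) > r n"
        using norm_triangle_ineq2[of y x] H[of n] that by (simp add: norm_minus_commute abs_le_iff)
      then show ?thesis by (simp add: supp)
    qed (simp add: h_def)
    then show "convolution w (\<eta> n) x = convolution h (\<eta> n) x" by (simp only: convolution_def)
    show "w x = h x" using that H[of 0] by (auto simp: h_def indicator_def)
  qed
  have err: "indicat_real (cball 0 R) x * \<bar>convolution w (\<eta> n) x - w x\<bar> \<le> \<bar>convolution h (\<eta> n) x - h x\<bar>"
    for n x using eq(1)[of x n] eq(2)[of x] by (cases "x \<in> cball 0 R") auto
  \<comment> \<open>For integrability any bound on the translation errors will do, and twice the
    norm is one that holds for every \<open>n\<close>.\<close>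
  have int_h: "integrable lborel (\<lambda>x. convolution h (\<eta> n) x - h x)" for n
    by (rule convolution_error(1)[OF h \<eta> pos one, where e = "2 * (\<integral>x. \<bar>h x\<bar> \<partial>lborel)"])
      (auto intro: translation_error_le_norm h)
  show int: "?I n" for n
  proof (rule Bochner_Integration.integrable_bound[OF int_h[of n]])
    show "(\<lambda>x. indicat_real (cball 0 R) x * (convolution w (\<eta> n) x - w x)) \<in> borel_measurable lborel"
      using L1_loc_measurable[OF w] borel_measurable_continuous_onI[OF convolution_continuous[OF w \<eta>], of n]
      by (intro borel_measurable_times borel_measurable_indicator borel_measurable_diff) auto
  qed (use err[of _ n] in \<open>auto simp: abs_mult\<close>)
  show "(\<lambda>n. \<integral>x. indicat_real (cball 0 R) x * \<bar>convolution w (\<eta> n) x - w x\<bar> \<partial>lborel) \<longlonglongrightarrow> 0"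
  proof (rule tendstoI)
    fix e :: real assume e: "e > 0"
    have "eventually (\<lambda>y. dist (translation_error h y) 0 < e / 2) (at 0)"
      using e by (intro tendstoD tendsto_translation_error h) simp
    then obtain d where d: "d > 0" "\<And>y. y \<noteq> 0 \<Longrightarrow> norm y < d \<Longrightarrow> translation_error h y < e / 2"
      by (auto simp: eventually_at translation_error_nonneg)
    have "eventually (\<lambda>n. r n < d) sequentially" using r d(1) by (rule order_tendstoD)
    then show "eventually (\<lambda>n. dist (\<integral>x. indicat_real (cball 0 R) x * \<bar>convolution w (\<eta> n) x - w x\<bar> \<partial>lborel) 0 < e) sequentially"
    proof eventually_elim
      case (elim n)
      have small: "translation_error h (- y) \<le> e / 2" if "\<eta> n y \<noteq> 0" for y
      \<comment> \<open>The limit at 0 is punctured and gives no information at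
        \<open>y = 0\<close>, where the error is 0 by definition.\<close>
      proof (cases "y = 0")
        case True then show ?thesis using e by (simp add: translation_error_def)
      next
        case False
        have "norm y \<le> r n" using that supp[of n y] by (cases "norm y \<le> r n") auto
        then show ?thesis using d(2)[of "- y"] False elim by simp
      qed
      have "(\<integral>x. indicat_real (cball 0 R) x * \<bar>convolution w (\<eta> n) x - w x\<bar> \<partial>lborel)
          \<le> (\<integral>x. \<bar>convolution h (\<eta> n) x - h x\<bar> \<partial>lborel)"
        using err integrable_abs[OF int[of n]] int_h[of n]
        by (intro integral_mono) (auto simp: abs_mult)
      also have "\<dots> \<le> e / 2"
        by (rule convolution_error(2)[OF h \<eta> pos one]) (use e small in auto)
      finally have "(\<integral>x. indicat_real (cball 0 R) x * \<bar>convolution w (\<eta> n) x - w x\<bar> \<partial>lborel) \<le> e / 2" .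
      moreover have "(\<integral>x. indicat_real (cball 0 R) x * \<bar>convolution w (\<eta> n) x - w x\<bar> \<partial>lborel) \<ge> 0"
        by (intro integral_nonneg_AE) auto
      ultimately show ?case using e by simp
    qed
  qed
qed

section \<open>Logarithmic cutoffs\<close>

text \<open>The classical function exp(-1/t), extended by 0, together with everything its
  derivatives produce. Differentiation replaces p by x^2 (p - p') with x = 1/t, the factor x^2
  coming from the chain rule, so the family is stable under derivatives.\<close>

definition flat :: "real poly \<Rightarrow> real \<Rightarrow> real" where
  "flat p t = (if t > 0 then poly p (1 / t) * exp (- (1 / t)) else 0)"

lemma tendsto_poly_exp_0: "((\<lambda>x::real. poly p x * exp (- x)) \<longlongrightarrow> 0) at_top"
proof -
  have "((\<lambda>x::real. \<Sum>i\<le>degree p. coeff p i * (x ^ i / exp x)) \<longlongrightarrow> (\<Sum>i\<le>degree p. coeff p i * 0)) at_top"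
    by (intro tendsto_intros tendsto_power_div_exp_0)
  then show ?thesis
    by (simp add: poly_altdef exp_minus sum_distrib_right divide_inverse mult.assoc)
qed

lemma tendsto_flat_0: "(flat p \<longlongrightarrow> 0) (at 0)"
proof (rule filterlim_split_at)
  have "((\<lambda>t. poly p (inverse t) * exp (- inverse t)) \<longlongrightarrow> 0) (at_right 0)"
    by (rule filterlim_compose[OF tendsto_poly_exp_0 filterlim_inverse_at_top_right])
  then show "(flat p \<longlongrightarrow> 0) (at_right 0)"
    by (rule Lim_transform_eventually)
      (auto simp: eventually_at_filter flat_def inverse_eq_divide)
  show "(flat p \<longlongrightarrow> 0) (at_left 0)"
    by (rule tendsto_eventually) (auto simp: eventually_at_filter flat_def)
qed

lemma flat_deriv: "(flat p has_real_derivative flat (monom 1 2 * (p - pderiv p)) t) (at t)"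
proof (cases t "0::real" rule: linorder_cases)
  case less
  have "((\<lambda>_. 0) has_real_derivative 0) (at t)" by simp
  then have "(flat p has_real_derivative 0) (at t)"
    by (rule has_field_derivative_transform_within_open[where S = "{..<0}"])
      (use less in \<open>auto simp: flat_def\<close>)
  then show ?thesis using less by (simp add: flat_def)
next
  case equal
  \<comment> \<open>Dividing by the increment multiplies the polynomial in 1/t by its variable, so
    the difference quotient at 0 is again a member of the family.\<close>
  have "(flat (pCons 0 p) \<longlongrightarrow> 0) (at 0)" by (rule tendsto_flat_0)
  then have "((\<lambda>h. (flat p (0 + h) - flat p 0) / h) \<longlongrightarrow> 0) (at 0)"
    by (rule Lim_transform_eventually) (auto simp: eventually_at_filter flat_def)
  then show ?thesis using equal by (simp add: DERIV_def flat_def)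
next
  case greater
  have "((\<lambda>t. poly p (1 / t) * exp (- (1 / t))) has_real_derivative
      poly (monom 1 2 * (p - pderiv p)) (1 / t) * exp (- (1 / t))) (at t)"
    using greater
    by (auto intro!: derivative_eq_intros DERIV_chain'[OF _ poly_DERIV]
       simp: poly_monom field_simps power2_eq_square)
  then have "(flat p has_real_derivative poly (monom 1 2 * (p - pderiv p)) (1 / t) * exp (- (1 / t))) (at t)"
    by (rule has_field_derivative_transform_within_open[where S = "{0<..}"])
      (use greater in \<open>auto simp: flat_def\<close>)
  then show ?thesis using greater by (simp add: flat_def)
qed

lemma continuous_on_flat: "continuous_on A (flat p)"
  by (rule DERIV_continuous_on[OF has_field_derivative_at_within[OF flat_deriv]])

lemma flat_bounded:
  obtains C where "C > 0" "\<And>t. t \<le> 1 \<Longrightarrow> \<bar>flat p t\<bar> \<le> C"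
proof -
  have "compact (flat p ` {0..1})"
    by (intro compact_continuous_image continuous_on_flat) simp
  then obtain C where C: "C > 0" "\<forall>y\<in>flat p ` {0..1}. norm y \<le> C"
    using compact_imp_bounded bounded_pos by metis
  have "\<bar>flat p t\<bar> \<le> C" if "t \<le> 1" for t
  proof (cases "t \<ge> 0")
    case True then show ?thesis using C(2) that by auto
  next
    case False then show ?thesis using C(1) by (simp add: flat_def)
  qed
  then show ?thesis using C(1) that by blast
qed

text \<open>For small \<open>c\<close> this is the logarithmic cutoff, whose Dirichlet energy tends to 0 in
  dimension at most two; for large \<open>c\<close> it concentrates at the origin and is used as a mollifier.\<close>
definition log_cutoff :: "real \<Rightarrow> 'a::euclidean_space \<Rightarrow> real" where
  "log_cutoff c x = flat 1 (1 - c * ln (1 + x \<bullet> x))"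

lemma has_real_derivative_inner_line:
  "((\<lambda>t::real. (x + t *\<^sub>R b) \<bullet> (x + t *\<^sub>R b)) has_real_derivative 2 * (x \<bullet> b)) (at 0)"
  by (auto simp: inner_simps inner_commute[of b x] intro!: derivative_eq_intros)

lemma add_1_inner_pos: "1 + x \<bullet> x > (0::real)"
  using inner_ge_zero[of x] by linarith

lemma add_1_inner_neq_0 [simp]: "1 + x \<bullet> x \<noteq> (0::real)"
  using add_1_inner_pos[of x] by simp

lemma flat_log_deriv:
  "((\<lambda>t::real. flat p (1 - c * ln (1 + (x + t *\<^sub>R b) \<bullet> (x + t *\<^sub>R b)))) has_real_derivative
     flat (monom 1 2 * (p - pderiv p)) (1 - c * ln (1 + x \<bullet> x)) * (- 2 * c) * (x \<bullet> b) * (1 / (1 + x \<bullet> x))) (at 0)"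
proof -
  have "((\<lambda>t::real. 1 - c * ln (1 + (x + t *\<^sub>R b) \<bullet> (x + t *\<^sub>R b))) has_real_derivative
      (- 2 * c) * (x \<bullet> b) * (1 / (1 + x \<bullet> x))) (at 0)"
    using add_1_inner_pos[of x]
    by (auto intro!: derivative_eq_intros has_real_derivative_inner_line simp: field_simps)
  from DERIV_chain2[OF flat_deriv this] show ?thesis by (simp add: mult.assoc)
qed

lemma smooth_fun_log_cutoff:
  fixes c :: real
  shows "smooth_fun (log_cutoff c :: 'a::euclidean_space \<Rightarrow> real)"
proof -
  define f where "f p x = flat p (1 - c * ln (1 + x \<bullet> x))" for p and x :: 'a
  \<comment> \<open>Differentiating \<open>f p\<close> changes the polynomial and produces
    constants, coordinates and the factor 1/(1 + |x|^2), so these generators suffice. The logarithm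
    stays inside \<open>flat\<close> and never appears as a factor.\<close>
  define A where "A = range (\<lambda>i x::'a. x \<bullet> i) \<union> {\<lambda>x. 1 / (1 + x \<bullet> x)} \<union> range f"
  have gen: "(\<lambda>x. x \<bullet> i) \<in> algebra_closure A" "(\<lambda>x. 1 / (1 + x \<bullet> x)) \<in> algebra_closure A"
    "f p \<in> algebra_closure A" for i p
    by (auto simp: A_def intro: algebra_closure.base)
  have "smooth_fun (f 1)"
  proof (rule smooth_fun_algebra_closure[OF _ _ gen(3)])
    have "continuous_on UNIV (f p)" for p
      unfolding f_def using add_1_inner_pos
      by (intro continuous_on_compose2[OF continuous_on_flat[of UNIV]] continuous_intros) auto
    moreover have "continuous_on UNIV (\<lambda>x::'a. 1 / (1 + x \<bullet> x))"
      by (intro continuous_intros) auto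
    ultimately show "continuous_on UNIV g" if "g \<in> A" for g
      using that by (auto simp: A_def intro!: continuous_intros)
  next
    fix g and b :: 'a assume "g \<in> A"
    then consider i where "g = (\<lambda>x. x \<bullet> i)" | "g = (\<lambda>x. 1 / (1 + x \<bullet> x))" | p where "g = f p"
      by (auto simp: A_def)
    then show "\<exists>g'\<in>algebra_closure A. \<forall>x. ((\<lambda>t::real. g (x + t *\<^sub>R b)) has_vector_derivative g' x) (at 0)"
    proof cases
      case 1
      show ?thesis
      proof (intro bexI allI)
        show "((\<lambda>t::real. g (x + t *\<^sub>R b)) has_vector_derivative b \<bullet> i) (at 0)" for x
          unfolding 1 has_real_derivative_iff_has_vector_derivative[symmetric]
          by (auto simp: inner_simps intro!: derivative_eq_intros)
      qed (rule algebra_closure.const)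
    next
      case 2
      show ?thesis
      proof (intro bexI allI)
        show "((\<lambda>t::real. g (x + t *\<^sub>R b)) has_vector_derivative
            (- 2) * ((x \<bullet> b) * (1 / (1 + x \<bullet> x) * (1 / (1 + x \<bullet> x))))) (at 0)" for x
          unfolding 2 has_real_derivative_iff_has_vector_derivative[symmetric]
          using add_1_inner_pos[of x]
          by (auto intro!: derivative_eq_intros has_real_derivative_inner_line simp: field_simps)
      qed (intro algebra_closure.const algebra_closure.mult gen)
    next
      case 3
      show ?thesis
      proof (intro bexI allI)
        show "((\<lambda>t::real. g (x + t *\<^sub>R b)) has_vector_derivative
            f (monom 1 2 * (p - pderiv p)) x * (- 2 * c) * (x \<bullet> b) * (1 / (1 + x \<bullet> x))) (at 0)" for x
          unfolding 3 has_real_derivative_iff_has_vector_derivative[symmetric] f_def by (rule flat_log_deriv)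
      qed (intro algebra_closure.const algebra_closure.mult gen)
    qed
  qed
  then show ?thesis by (simp add: f_def[abs_def] log_cutoff_def[abs_def])
qed

text \<open>The argument of \<open>flat\<close> is negative once 1 + |x|^2 exceeds exp(1/c). The
  radius tends to infinity as c tends to 0, and to 0 as c tends to infinity, as the two uses of the
  function require.\<close>

lemma log_cutoff_eq_0:
  assumes "c > 0" "norm x > sqrt (exp (1 / c) - 1)"
  shows "log_cutoff c x = 0"
proof -
  have "exp (1 / c) \<ge> 1" using assms(1) by simp
  then have "exp (1 / c) - 1 < (norm x)\<^sup>2"
    using assms(2) by (metis diff_ge_0_iff_ge real_sqrt_ge_zero real_sqrt_pow2 power_strict_mono zero_less_numeral)
  then have "exp (1 / c) < 1 + x \<bullet> x" by (simp add: power2_norm_eq_inner)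
  then have "1 / c < ln (1 + x \<bullet> x)"
    using add_1_inner_pos[of x] by (metis exp_less_cancel_iff exp_ln)
  then have "1 < c * ln (1 + x \<bullet> x)" using assms(1) by (simp add: field_simps)
  then show ?thesis by (simp add: log_cutoff_def flat_def)
qed

lemma test_fun_log_cutoff: "c > 0 \<Longrightarrow> test_fun (log_cutoff c :: 'a::euclidean_space \<Rightarrow> real)"
  unfolding test_fun_iff using smooth_fun_log_cutoff log_cutoff_eq_0 by blast

lemma log_cutoff_bounds: "c > 0 \<Longrightarrow> 0 \<le> log_cutoff c x" "c > 0 \<Longrightarrow> log_cutoff c x \<le> 1"
  by (auto simp: log_cutoff_def flat_def)

text \<open>The argument of \<open>flat 1\<close> tends to 1, where its value is exp(-1). The
  cutoffs are not normalized; this constant is divided out at the end of the argument.\<close>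

lemma tendsto_log_cutoff:
  "(\<lambda>n. log_cutoff (1 / real (Suc n)) x) \<longlonglongrightarrow> exp (- 1)"
proof -
  have c: "isCont (flat 1) 1" using continuous_on_flat[of UNIV] by (simp add: continuous_on_eq_continuous_at)
  have "(\<lambda>n. 1 - 1 / real (Suc n) * ln (1 + x \<bullet> x)) \<longlonglongrightarrow> 1 - 0 * ln (1 + x \<bullet> x)"
    by (intro tendsto_intros LIMSEQ_Suc[OF lim_1_over_n])
  then have "(\<lambda>n. flat 1 (1 - 1 / real (Suc n) * ln (1 + x \<bullet> x))) \<longlonglongrightarrow> flat 1 1"
    by (intro isCont_tendsto_compose[OF c]) simp
  then show ?thesis by (simp add: log_cutoff_def flat_def)
qed

lemma integral_log_cutoff_pos:
  assumes "c > 0"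
  shows "(\<integral>x. log_cutoff c x \<partial>(lborel :: 'a::euclidean_space measure)) > 0"
proof (rule ccontr)
  let ?f = "log_cutoff c :: 'a \<Rightarrow> real"
  note tf = test_fun_log_cutoff[OF assms, where 'a = 'a]
  have nonneg: "0 \<le> ?f x" for x by (rule log_cutoff_bounds(1)[OF assms])
  assume "\<not> 0 < (\<integral>x. ?f x \<partial>lborel)"
  moreover have "0 \<le> (\<integral>x. ?f x \<partial>lborel)" by (simp add: nonneg)
  ultimately have "(\<integral>x. ?f x \<partial>lborel) = 0" by simp
  then have ae: "AE x in lborel. ?f x = 0"
    using integral_nonneg_eq_0_iff_AE[OF integrable_test_fun[OF tf]] nonneg by simp
  define U where "U = {x. ?f x \<noteq> 0}"
  have "open U" unfolding U_def
    by (intro open_Collect_neq smooth_funD(1)[OF smooth_fun_log_cutoff] continuous_on_const)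
  moreover have "0 \<in> U" by (simp add: U_def log_cutoff_def flat_def)
  ultimately obtain e where e: "e > 0" "ball 0 e \<subseteq> U" by (meson open_contains_ball)
  have "emeasure lborel U = 0"
    using ae \<open>open U\<close> AE_iff_measurable[of U lborel "\<lambda>x. ?f x = 0"] by (simp add: U_def)
  then have "U \<in> null_sets lborel" using \<open>open U\<close> by (intro null_setsI) auto
  then have "emeasure lborel (ball 0 e :: 'a set) = 0"
    using e(2) null_sets_subset[of U lborel "ball 0 e"] by auto
  then show False using content_ball_pos[OF e(1), of "0::'a"] by (simp add: measure_def)
qed

text \<open>A substitute for polar coordinates. With k the ceiling of ln(1 + |x|^2), the point lies
  in the ball of radius exp(k/2) and 1/(1 + |x|^2) is at most exp(1 - k), so the k-th summand alone
  is large enough. The integral of each summand is a ball volume.\<close>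

lemma inverse_inner_le_dyadic_sum:
  fixes x :: "'a::euclidean_space"
  assumes "1 + x \<bullet> x < exp (real n)"
  shows "1 / (1 + x \<bullet> x) \<le> (\<Sum>k\<le>n. exp (1 - real k) * indicat_real (cball 0 (exp (real k / 2))) x)"
proof -
  let ?s = "1 + x \<bullet> x"
  define k where "k = nat \<lceil>ln ?s\<rceil>"
  have s: "?s > 0" by (rule add_1_inner_pos)
  have "ln ?s \<ge> 0" using inner_ge_zero[of x] by simp
  then have k: "ln ?s \<le> real k" "real k < ln ?s + 1" by (auto simp: k_def ceiling_correct) linarith+
  have "ln ?s < real n" using assms s by (metis exp_ln exp_less_cancel_iff)
  then have "k \<le> n" using k(2) by linarith
  have "x \<bullet> x \<le> exp (real k)"
    using k(1) s by (metis exp_le_cancel_iff exp_ln le_add_same_cancel2 order_trans zero_le_one)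
  also have "\<dots> = (exp (real k / 2))\<^sup>2" by (simp add: power2_eq_square exp_add[symmetric])
  finally have "norm x \<le> exp (real k / 2)" unfolding norm_eq_sqrt_inner by (intro real_le_lsqrt) auto
  moreover have "1 / ?s \<le> exp (1 - real k)"
  proof -
    have "exp (real k - 1) \<le> exp (ln ?s)" using k(2) by simp
    then have "exp (real k - 1) \<le> ?s" using s by simp
    then have "1 / ?s \<le> 1 / exp (real k - 1)" by (intro divide_left_mono) (use s in auto)
    then show ?thesis by (simp add: exp_diff)
  qed
  ultimately have "1 / ?s \<le> exp (1 - real k) * indicat_real (cball 0 (exp (real k / 2))) x" by simp
  also have "\<dots> \<le> (\<Sum>k\<le>n. exp (1 - real k) * indicat_real (cball 0 (exp (real k / 2))) x)"
    using \<open>k \<le> n\<close> by (intro member_le_sum) auto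
  finally show ?thesis .
qed

text \<open>With c = 1/(n+1), the squared gradient is at most 4 C^2 c^2/(1 + |x|^2) on the support.
  The dyadic sum has n + 2 terms, each of integral at most e times the volume of the unit ball, and
  c^2 (n + 2) <= 2c.\<close>

lemma log_cutoff_energy:
  assumes dim: "DIM('a::euclidean_space) \<le> 2"
  shows "(\<lambda>n. \<integral>x. (\<Sum>b\<in>Basis. (pd b (log_cutoff (1 / real (Suc n))) x)\<^sup>2) \<partial>(lborel :: 'a measure)) \<longlonglongrightarrow> 0"
proof -
  \<comment> \<open>The polynomial belonging to the first derivative of \<open>flat 1\<close>, in
    the shape produced by \<open>flat_deriv\<close>. A bound for arguments up to 1 is enough because
    the logarithm is nonnegative.\<close>
  let ?q = "monom 1 2 * (1 - pderiv 1) :: real poly"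
  obtain C where C: "C > 0" "\<And>t. t \<le> 1 \<Longrightarrow> \<bar>flat ?q t\<bar> \<le> C" using flat_bounded[of ?q] by blast
  define v where "v = measure lborel (cball 0 1 :: 'a set)"
  have bound: "(\<integral>x. (\<Sum>b\<in>Basis. (pd b (log_cutoff (1 / real (Suc n))) x)\<^sup>2) \<partial>(lborel :: 'a measure))
      \<le> 8 * C\<^sup>2 * exp 1 * v * (1 / real (Suc n))" for n
  proof -
    define c where "c = 1 / real (Suc n)"
    have c: "c > 0" by (simp add: c_def)
    let ?S = "\<lambda>x::'a. \<Sum>k\<le>Suc n. exp (1 - real k) * indicat_real (cball 0 (exp (real k / 2))) x"
    have S_nonneg: "?S x \<ge> 0" for x by (intro sum_nonneg) auto
    have ptwise: "(\<Sum>b\<in>Basis. (pd b (log_cutoff c) x)\<^sup>2) \<le> 4 * C\<^sup>2 * c\<^sup>2 * ?S x" for x :: 'a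
    proof -
      let ?s = "1 + x \<bullet> x"
      let ?f = "flat ?q (1 - c * ln ?s)"
      have s: "?s > 0" by (rule add_1_inner_pos)
      have pd: "pd b (log_cutoff c) x = ?f * (- 2 * c) * (x \<bullet> b) * (1 / ?s)" for b :: 'a
        unfolding log_cutoff_def using flat_log_deriv[of 1 c x b]
        by (intro pd_eqI) (simp add: has_real_derivative_iff_has_vector_derivative)
      have xx: "(\<Sum>b\<in>Basis. (x \<bullet> b)\<^sup>2) = x \<bullet> x"
        by (simp add: euclidean_inner[of x x] power2_eq_square)
      have "(\<Sum>b\<in>Basis. (pd b (log_cutoff c) x)\<^sup>2) = (\<Sum>b\<in>Basis. 4 * c\<^sup>2 * ?f\<^sup>2 * (1 / ?s)\<^sup>2 * (x \<bullet> b)\<^sup>2)"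
        unfolding pd by (intro sum.cong refl) (simp only: power_mult_distrib, simp)
      also have "\<dots> = 4 * c\<^sup>2 * ?f\<^sup>2 * (1 / ?s)\<^sup>2 * (x \<bullet> x)"
        unfolding sum_distrib_left[symmetric] xx ..
      also have "\<dots> \<le> 4 * C\<^sup>2 * c\<^sup>2 * ?S x"
      proof (cases "1 - c * ln ?s > 0")
        case False
        then show ?thesis using S_nonneg by (simp add: flat_def)
      next
        case True
        then have "ln ?s < real (Suc n)" by (simp add: c_def field_simps)
        then have "exp (ln ?s) < exp (real (Suc n))" by (simp only: exp_less_cancel_iff)
        then have "?s < exp (real (Suc n))" using s by simp
        then have 1: "1 / ?s \<le> ?S x" by (rule inverse_inner_le_dyadic_sum)
        have "(1 / ?s)\<^sup>2 * (x \<bullet> x) = (1 / ?s) * ((x \<bullet> x) / ?s)" by (simp add: power2_eq_square)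
        also have "\<dots> \<le> (1 / ?s) * 1" using s by (intro mult_left_mono) auto
        finally have 2: "(1 / ?s)\<^sup>2 * (x \<bullet> x) \<le> ?S x" using 1 by simp
        have "ln ?s \<ge> 0" using inner_ge_zero[of x] by simp
        then have "\<bar>?f\<bar> \<le> C" using c by (intro C) simp
        then have "?f\<^sup>2 \<le> C\<^sup>2" using power_mono[of "\<bar>?f\<bar>" C 2] by simp
        then have "?f\<^sup>2 * ((1 / ?s)\<^sup>2 * (x \<bullet> x)) \<le> C\<^sup>2 * ?S x" using 2 by (intro mult_mono) auto
        then have "4 * c\<^sup>2 * (?f\<^sup>2 * ((1 / ?s)\<^sup>2 * (x \<bullet> x))) \<le> 4 * c\<^sup>2 * (C\<^sup>2 * ?S x)"
          by (intro mult_left_mono) auto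
        then show ?thesis by (simp only: mult_ac)
      qed
      finally show ?thesis .
    qed
    have int_term: "integrable lborel (\<lambda>x::'a. exp (1 - real k) * indicat_real (cball 0 (exp (real k / 2))) x)" for k
      using emeasure_bounded_finite[of "cball 0 (exp (real k / 2)) :: 'a set"]
      by (intro integrable_mult_right integrable_real_indicator) auto
    have term_le: "(\<integral>x. exp (1 - real k) * indicat_real (cball 0 (exp (real k / 2))) x \<partial>(lborel :: 'a measure)) \<le> exp 1 * v" for k
    proof -
      let ?r = "exp (real k / 2)"
      \<comment> \<open>The radius is at least 1, so the dimension bound makes the volume grow no
        faster than exp(k), exactly what the weight exp(1 - k) can absorb.\<close>
      have "?r ^ DIM('a) \<le> ?r ^ 2" using dim by (intro power_increasing) auto
      also have "\<dots> = exp (real k)" by (simp add: power2_eq_square exp_add[symmetric])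
      finally have r: "?r ^ DIM('a) \<le> exp (real k)" .
      have "measure lborel (cball 0 ?r :: 'a set) = v * ?r ^ DIM('a)" by (simp add: content_cball v_def)
      also have "\<dots> \<le> v * exp (real k)" using r by (intro mult_left_mono) (auto simp: v_def)
      finally have "exp (1 - real k) * measure lborel (cball 0 ?r :: 'a set) \<le> exp (1 - real k) * (v * exp (real k))"
        by (intro mult_left_mono) auto
      then show ?thesis by (simp add: exp_diff)
    qed
    have "(\<integral>x. (\<Sum>b\<in>Basis. (pd b (log_cutoff c) x)\<^sup>2) \<partial>(lborel :: 'a measure))
        \<le> (\<integral>x. 4 * C\<^sup>2 * c\<^sup>2 * ?S x \<partial>lborel)"
    proof (rule integral_mono[OF _ _ ptwise])
      have "test_fun (\<lambda>x. (pd b (log_cutoff c) x)\<^sup>2 :: real)" if "b \<in> Basis" for b :: 'a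
        unfolding power2_eq_square
        using test_fun_pd[OF test_fun_log_cutoff[OF c] that] by (intro test_fun_mult test_fun_smooth)
      then show "integrable lborel (\<lambda>x::'a. \<Sum>b\<in>Basis. (pd b (log_cutoff c) x)\<^sup>2)"
        by (intro Bochner_Integration.integrable_sum integrable_test_fun)
      show "integrable lborel (\<lambda>x. 4 * C\<^sup>2 * c\<^sup>2 * ?S x)"
        by (intro integrable_mult_right Bochner_Integration.integrable_sum int_term)
    qed
    also have "\<dots> = 4 * C\<^sup>2 * c\<^sup>2 * (\<Sum>k\<le>Suc n. \<integral>x. exp (1 - real k) * indicat_real (cball 0 (exp (real k / 2))) x \<partial>(lborel :: 'a measure))"
      by (simp only: integral_mult_right_zero Bochner_Integration.integral_sum[OF int_term])
    also have "\<dots> \<le> 4 * C\<^sup>2 * c\<^sup>2 * (\<Sum>k\<le>Suc n. exp 1 * v)"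
      by (intro mult_left_mono sum_mono term_le) auto
    also have "\<dots> = 4 * C\<^sup>2 * exp 1 * v * (c\<^sup>2 * (real (Suc n) + 1))" by (simp add: algebra_simps)
    also have "\<dots> \<le> 4 * C\<^sup>2 * exp 1 * v * (2 * c)"
    proof (rule mult_left_mono)
      have "c\<^sup>2 * (real (Suc n) + 1) = c * (c * real (Suc n) + c)"
        by (simp add: power2_eq_square algebra_simps)
      also have "\<dots> = c * (1 + c)" by (simp add: c_def)
      also have "\<dots> \<le> c * 2" using c by (intro mult_left_mono) (auto simp: c_def)
      finally show "c\<^sup>2 * (real (Suc n) + 1) \<le> 2 * c" by simp
    qed (simp add: v_def)
    finally show ?thesis by (simp add: c_def)
  qed
  have "(\<lambda>n. 8 * C\<^sup>2 * exp 1 * v * (1 / real (Suc n))) \<longlonglongrightarrow> 8 * C\<^sup>2 * exp 1 * v * 0"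
    by (intro tendsto_intros LIMSEQ_Suc[OF lim_1_over_n])
  then have "(\<lambda>n. 8 * C\<^sup>2 * exp 1 * v * (1 / real (Suc n))) \<longlonglongrightarrow> 0" by simp
  then show ?thesis
    by (rule Lim_null_comparison[rotated])
      (use bound in \<open>auto simp: abs_of_nonneg sum_nonneg\<close>)
qed

text \<open>The supports shrink because the parameter of the cutoff grows, not because the variable
  is rescaled. Hence only the mass has to be normalized, and no change of variables occurs.\<close>

lemma mollifier_exists:
  obtains \<eta> :: "nat \<Rightarrow> 'a::euclidean_space \<Rightarrow> real" and r :: "nat \<Rightarrow> real"
  where "\<And>n. test_fun (\<eta> n)" "\<And>n y. 0 \<le> \<eta> n y" "\<And>n. (\<integral>y. \<eta> n y \<partial>lborel) = 1"
    "\<And>n y. norm y > r n \<Longrightarrow> \<eta> n y = 0" "r \<longlonglongrightarrow> 0"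
proof -
  define I where "I n = (\<integral>x. log_cutoff (real (Suc n)) x \<partial>(lborel :: 'a measure))" for n
  define \<eta> where "\<eta> n x = log_cutoff (real (Suc n)) x * (1 / I n)" for n and x :: 'a
  define r where "r n = sqrt (exp (1 / real (Suc n)) - 1)" for n
  have I: "I n > 0" for n unfolding I_def by (rule integral_log_cutoff_pos) simp
  have "test_fun (\<eta> n)" for n
    unfolding \<eta>_def by (intro test_fun_mult test_fun_log_cutoff) auto
  moreover have "0 \<le> \<eta> n y" for n y
    using I[of n] log_cutoff_bounds(1)[of "real (Suc n)" y] by (simp add: \<eta>_def)
  moreover have "(\<integral>y. \<eta> n y \<partial>lborel) = 1" for n
    using I[of n] unfolding \<eta>_def by (simp add: I_def del: of_nat_Suc)
  moreover have "\<eta> n y = 0" if "norm y > r n" for n y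
    using that log_cutoff_eq_0[of "real (Suc n)" y] by (simp add: \<eta>_def r_def)
  moreover have "r \<longlonglongrightarrow> sqrt (exp 0 - 1)"
    unfolding r_def by (intro tendsto_intros LIMSEQ_Suc[OF lim_1_over_n])
  then have "r \<longlonglongrightarrow> 0" by simp
  ultimately show ?thesis by (rule that)
qed

section \<open>The ground state form\<close>

lemma test_fun_sum:
  fixes f :: "'i \<Rightarrow> 'a::euclidean_space \<Rightarrow> real"
  assumes "finite I" "\<And>i. i \<in> I \<Longrightarrow> test_fun (f i)"
  shows "test_fun (\<lambda>x. \<Sum>i\<in>I. f i x)"
  using assms
proof (induction I rule: finite_induct)
  case empty
  show ?case by (auto simp: test_fun_iff)
qed (simp add: test_fun_add)

lemma test_fun_laplacian:
  fixes f :: "'a::euclidean_space \<Rightarrow> real"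
  shows "test_fun f \<Longrightarrow> test_fun (laplacian f)"
  unfolding laplacian_def[abs_def] by (intro test_fun_sum test_fun_pd) auto

lemma pd_cmult:
  fixes f :: "'a::euclidean_space \<Rightarrow> real"
  assumes "smooth_fun f" "b \<in> Basis"
  shows "pd b (\<lambda>x. c * f x) x = c * pd b f x"
  using pd_mult[OF smooth_fun_const assms] by (simp add: pd_const)

lemma laplacian_reflect:
  fixes f :: "'a::euclidean_space \<Rightarrow> real"
  assumes "smooth_fun f"
  shows "laplacian (\<lambda>y. f (x - y)) y = laplacian f (x - y)"
  unfolding laplacian_def
proof (rule sum.cong)
  fix b :: 'a assume b: "b \<in> Basis"
  have "pd b (\<lambda>y. f (x - y)) = (\<lambda>y. (-1) * pd b f (x - y))"
    using pd_reflect[OF assms b] by auto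
  then show "pd b (pd b (\<lambda>y. f (x - y))) y = pd b (pd b f) (x - y)"
    using smooth_funD(3)[OF assms b] b by (simp only: pd_cmult smooth_fun_reflect pd_reflect)
qed simp

text \<open>The right-hand side is written as a pairing with the Laplacian of the reflected kernel
  in \<open>y\<close>, the form in which the weak equation can be applied. The two signs from
  reflecting cancel.\<close>

lemma laplacian_convolution:
  fixes w g :: "'a::euclidean_space \<Rightarrow> real"
  assumes w: "L1_loc w" and g: "test_fun g"
  shows "laplacian (convolution w g) x = (\<integral>y. w y * laplacian (\<lambda>y. g (x - y)) y \<partial>lborel)"
proof -
  have "laplacian (convolution w g) x = (\<Sum>b\<in>Basis. convolution w (pd b (pd b g)) x)"
    unfolding laplacian_def by (intro sum.cong refl) (simp add: pd_convolution w g test_fun_pd)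
  also have "\<dots> = (\<integral>y. (\<Sum>b\<in>Basis. w y * pd b (pd b g) (x - y)) \<partial>lborel)"
    unfolding convolution_def
    by (intro Bochner_Integration.integral_sum[symmetric] convolution_integrable w test_fun_pd g)
  also have "\<dots> = (\<integral>y. w y * laplacian (\<lambda>y. g (x - y)) y \<partial>lborel)"
    unfolding laplacian_reflect[OF test_fun_smooth[OF g]] by (simp add: laplacian_def sum_distrib_left)
  finally show ?thesis .
qed

section \<open>Gradient energy and the quadratic form on real functions\<close>

definition grad_sq :: "('a::euclidean_space \<Rightarrow> real) \<Rightarrow> 'a \<Rightarrow> real" where
  "grad_sq f x = (\<Sum>b\<in>Basis. (pd b f x)\<^sup>2)"

lemma test_fun_grad_sq:
  fixes f :: "'a::euclidean_space \<Rightarrow> real"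
  assumes "test_fun f" shows "test_fun (grad_sq f)"
  unfolding grad_sq_def[abs_def] power2_eq_square
  by (intro test_fun_sum test_fun_mult test_fun_pd test_fun_smooth[OF test_fun_pd] assms) auto

lemma test_fun_of_real:
  fixes f :: "'a::euclidean_space \<Rightarrow> real"
  shows "test_fun f \<Longrightarrow> test_fun (\<lambda>x. complex_of_real (f x))"
  unfolding test_fun_iff by (auto intro: smooth_fun_of_real)

lemma qform_of_real:
  fixes W f :: "'a::euclidean_space \<Rightarrow> real"
  assumes W: "L1_loc W" and f: "test_fun f"
  shows "qform W (\<lambda>x. complex_of_real (f x))
    = (\<integral>x. grad_sq f x \<partial>lborel) + (\<integral>x. W x * (f x)\<^sup>2 \<partial>lborel)"
proof -
  have fs: "smooth_fun f" by (rule test_fun_smooth[OF f])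
  have "qform W (\<lambda>x. complex_of_real (f x)) = (\<integral>x. grad_sq f x + W x * (f x)\<^sup>2 \<partial>lborel)"
    unfolding qform_def grad_sq_def
    by (intro Bochner_Integration.integral_cong) (auto simp: pd_of_real[OF fs])
  also have "\<dots> = (\<integral>x. grad_sq f x \<partial>lborel) + (\<integral>x. W x * (f x)\<^sup>2 \<partial>lborel)"
    unfolding power2_eq_square
    by (intro Bochner_Integration.integral_add integrable_test_fun test_fun_grad_sq
        L1_loc_integrable_test_fun W test_fun_mult f fs)
  finally show ?thesis .
qed

lemma L2normsq_of_real: "L2normsq (\<lambda>x. complex_of_real (f x)) = (\<integral>x. (f x)\<^sup>2 \<partial>lborel)"
  by (simp add: L2normsq_def)

text \<open>The integrands of the two sides differ by the divergence of \<open>f\<^sup>2 u \<nabla>u\<close>.\<close>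
lemma integral_grad_sq_mult:
  fixes u f :: "'a::euclidean_space \<Rightarrow> real"
  assumes u: "smooth_fun u" and f: "test_fun f"
  shows "(\<integral>x. grad_sq (\<lambda>x. u x * f x) x \<partial>lborel)
    = (\<integral>x. grad_sq f x * (u x)\<^sup>2 \<partial>lborel) - (\<integral>x. (f x)\<^sup>2 * u x * laplacian u x \<partial>lborel)"
proof -
  have fs: "smooth_fun f" by (rule test_fun_smooth[OF f])
  define k where "k b x = (f x * f x) * (u x * pd b u x)" for b x
  have k: "test_fun (k b)" if "b \<in> Basis" for b
    unfolding k_def by (intro test_fun_mult smooth_fun_mult smooth_funD(3) f fs u that)
  have ptwise: "grad_sq (\<lambda>x. u x * f x) x
      = grad_sq f x * (u x)\<^sup>2 - (f x)\<^sup>2 * u x * laplacian u x + (\<Sum>b\<in>Basis. pd b (k b) x)" for x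
  proof -
    have "(pd b (\<lambda>x. u x * f x) x)\<^sup>2
        = (pd b f x)\<^sup>2 * (u x)\<^sup>2 - (f x)\<^sup>2 * u x * pd b (pd b u) x + pd b (k b) x" if b: "b \<in> Basis" for b
    proof -
      have u': "smooth_fun (pd b u)" by (rule smooth_funD(3)[OF u b])
      have "pd b (k b) x = (f x * f x) * (u x * pd b (pd b u) x + pd b u x * pd b u x)
          + (f x * pd b f x + pd b f x * f x) * (u x * pd b u x)"
        unfolding k_def pd_mult[OF smooth_fun_mult[OF fs fs] smooth_fun_mult[OF u u'] b]
          pd_mult[OF fs fs b] pd_mult[OF u u' b] ..
      then show ?thesis
        unfolding pd_mult[OF u fs b] by (simp add: power2_eq_square algebra_simps)
    qed
    then show ?thesis
      by (simp add: grad_sq_def laplacian_def sum.distrib sum_subtractf sum_distrib_left sum_distrib_right)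
  qed
  have lap: "smooth_fun (laplacian u)"
    unfolding laplacian_def[abs_def]
  proof -
    have "smooth_fun (\<lambda>x. \<Sum>b\<in>I. pd b (pd b u) x)" if "finite I" "I \<subseteq> Basis" for I
      using that by (induction I rule: finite_induct) (auto intro!: smooth_fun_add smooth_funD(3) u)
    then show "smooth_fun (\<lambda>x. \<Sum>b\<in>Basis. pd b (pd b u) x)" by simp
  qed
  have i1: "integrable lborel (\<lambda>x. grad_sq f x * (u x)\<^sup>2)"
    unfolding power2_eq_square
    by (intro integrable_test_fun test_fun_mult test_fun_grad_sq smooth_fun_mult f u)
  have i2: "integrable lborel (\<lambda>x. (f x)\<^sup>2 * u x * laplacian u x)"
    unfolding power2_eq_square by (intro integrable_test_fun test_fun_mult f fs u lap)
  have i3: "integrable lborel (\<lambda>x. pd b (k b) x)" if "b \<in> Basis" for b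
    using that by (intro integrable_test_fun test_fun_pd k)
  have "(\<integral>x. (\<Sum>b\<in>Basis. pd b (k b) x) \<partial>lborel) = 0"
    using i3 by (simp add: Bochner_Integration.integral_sum integral_pd_eq_0 k)
  moreover have "integrable lborel (\<lambda>x. \<Sum>b\<in>Basis. pd b (k b) x)"
    by (intro Bochner_Integration.integrable_sum i3)
  ultimately show ?thesis unfolding ptwise using i1 i2 by simp
qed

text \<open>\<eta> is a probability density, so the convolution averages values of \<open>w\<close>.
  The bound does not depend on the mollifier, hence holds uniformly along a mollifying
  sequence.\<close>

lemma convolution_abs_le:
  fixes w \<eta> :: "'a::euclidean_space \<Rightarrow> real"
  assumes w: "L1_loc w" and M: "\<And>x. \<bar>w x\<bar> \<le> M" and \<eta>: "test_fun \<eta>" and pos: "\<And>y. 0 \<le> \<eta> y"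
    and one: "(\<integral>y. \<eta> y \<partial>lborel) = 1"
  shows "\<bar>convolution w \<eta> x\<bar> \<le> M"
proof -
  have "\<bar>convolution w \<eta> x\<bar> \<le> (\<integral>y. M * \<eta> (x - y) \<partial>lborel)"
    unfolding convolution_def
  proof (rule integral_abs_bound_integral)
    show "integrable lborel (\<lambda>y. M * \<eta> (x - y))"
      by (intro integrable_mult_right integrable_test_fun test_fun_reflect \<eta>)
    show "\<bar>w y * \<eta> (x - y)\<bar> \<le> M * \<eta> (x - y)" for y
      using mult_right_mono[OF M pos, of y "x - y"] pos[of "x - y"] by (simp add: abs_mult)
  qed (rule convolution_integrable[OF w \<eta>])
  also have "\<dots> = M"
    using one integral_lborel_reflect[OF smooth_fun_measurable[OF test_fun_smooth[OF \<eta>]], of x] by simp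
  finally show ?thesis .
qed

text \<open>Testing the form with \<open>u n * f\<close> gives the weighted energy of
  \<open>f\<close> and a term with the Laplacian of \<open>u n\<close>. In the limit that Laplacian
  becomes (Q - E) psi, which cancels the contribution of E and leaves \<open>W - Q\<close> as the
  potential.\<close>

lemma ground_state_form_nonneg:
  fixes Q W \<psi> f :: "'a::euclidean_space \<Rightarrow> real"
  assumes Q: "L1_loc Q" and W: "L1_loc W"
    and \<psi>: "L1_loc \<psi>" and M: "\<And>x. \<bar>\<psi> x\<bar> \<le> M"
    and eq: "\<And>\<phi>::'a \<Rightarrow> real. test_fun \<phi> \<Longrightarrow>
        (\<integral>x. - \<psi> x * laplacian \<phi> x + Q x * \<psi> x * \<phi> x \<partial>lborel) = E * (\<integral>x. \<psi> x * \<phi> x \<partial>lborel)"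
    and form: "\<And>\<phi>::'a \<Rightarrow> complex. test_fun \<phi> \<Longrightarrow> qform W \<phi> \<ge> E * L2normsq \<phi>"
    and f: "test_fun f"
  shows "0 \<le> (\<integral>x. grad_sq f x * (\<psi> x)\<^sup>2 \<partial>lborel) + (\<integral>x. (W x - Q x) * ((f x)\<^sup>2 * (\<psi> x)\<^sup>2) \<partial>lborel)"
proof -
  have fs: "smooth_fun f" by (rule test_fun_smooth[OF f])
  have \<psi>m: "\<psi> \<in> borel_measurable borel" by (rule L1_loc_measurable[OF \<psi>])
  obtain \<eta> :: "nat \<Rightarrow> 'a \<Rightarrow> real" and r where
    \<eta>: "\<And>n. test_fun (\<eta> n)" and pos: "\<And>n y. 0 \<le> \<eta> n y" and one: "\<And>n. (\<integral>y. \<eta> n y \<partial>lborel) = 1"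
    and supp: "\<And>n y. norm y > r n \<Longrightarrow> \<eta> n y = 0" and r: "r \<longlonglongrightarrow> 0"
    using mollifier_exists by blast
  note L1_limit = tendsto_convolution_L1[where \<eta> = \<eta> and r = r, OF _ \<eta> pos one supp r]
  obtain R where R: "\<And>x. norm x > R \<Longrightarrow> f x = 0" using test_fun_support[OF f] by blast
  define u where "u n = convolution \<psi> (\<eta> n)" for n
  \<comment> \<open>By the weak equation \<open>h\<close> is the distributional Laplacian of \<psi>.
    It is locally integrable because \<psi> is bounded.\<close>
  define h where "h x = (Q x + - E) * \<psi> x" for x
  have h: "L1_loc h"
    unfolding h_def[abs_def] by (rule L1_loc_mult_bounded[OF L1_loc_add[OF Q L1_loc_const] \<psi>m M])
  have us: "smooth_fun (u n)" for n unfolding u_def by (rule smooth_fun_convolution[OF \<psi> \<eta>])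
  have uM: "\<bar>u n x\<bar> \<le> M" for n x unfolding u_def by (rule convolution_abs_le[OF \<psi> M \<eta> pos one])
  have M0: "M \<ge> 0" using M[of 0] by linarith
  have lap: "laplacian (u n) x = convolution h (\<eta> n) x" for n x
  proof -
    let ?\<phi> = "\<lambda>y. \<eta> n (x - y)"
    have \<phi>: "test_fun ?\<phi>" by (rule test_fun_reflect[OF \<eta>])
    have Q\<psi>: "L1_loc (\<lambda>x. Q x * \<psi> x)" by (rule L1_loc_mult_bounded[OF Q \<psi>m M])
    note i = L1_loc_integrable_test_fun[OF \<psi> test_fun_laplacian[OF \<phi>]]
      L1_loc_integrable_test_fun[OF Q\<psi> \<phi>] L1_loc_integrable_test_fun[OF \<psi> \<phi>]
    have "- (\<integral>y. \<psi> y * laplacian ?\<phi> y \<partial>lborel) + (\<integral>y. Q y * \<psi> y * ?\<phi> y \<partial>lborel)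
        = E * (\<integral>y. \<psi> y * ?\<phi> y \<partial>lborel)"
      using eq[OF \<phi>] i by simp
    then have "(\<integral>y. \<psi> y * laplacian ?\<phi> y \<partial>lborel)
        = (\<integral>y. Q y * \<psi> y * ?\<phi> y \<partial>lborel) - (\<integral>y. E * (\<psi> y * ?\<phi> y) \<partial>lborel)"
      by simp
    also have "\<dots> = (\<integral>y. Q y * \<psi> y * ?\<phi> y - E * (\<psi> y * ?\<phi> y) \<partial>lborel)"
      using i by simp
    also have "\<dots> = convolution h (\<eta> n) x"
      unfolding convolution_def h_def by (intro Bochner_Integration.integral_cong) (auto simp: algebra_simps)
    finally show ?thesis
      unfolding u_def laplacian_convolution[OF \<psi> \<eta>] .
  qed
  have ineq: "E * (\<integral>x. (f x)\<^sup>2 * (u n x)\<^sup>2 \<partial>lborel)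
      \<le> (\<integral>x. grad_sq f x * (u n x)\<^sup>2 \<partial>lborel) - (\<integral>x. (f x)\<^sup>2 * u n x * convolution h (\<eta> n) x \<partial>lborel)
        + (\<integral>x. W x * ((f x)\<^sup>2 * (u n x)\<^sup>2) \<partial>lborel)" for n
  proof -
    have uf: "test_fun (\<lambda>x. u n x * f x)" by (rule test_fun_mult(2)[OF f us])
    show ?thesis
      using form[OF test_fun_of_real[OF uf]]
      unfolding qform_of_real[OF W uf] L2normsq_of_real integral_grad_sq_mult[OF us f] lap
      by (simp add: power_mult_distrib mult_ac)
  qed
  \<comment> \<open>L1 convergence on the ball gives convergence almost everywhere only along a
    subsequence. The ball suffices because \<open>f\<close> vanishes outside it.\<close>
  obtain s where s: "strict_mono s"
    "AE x in lborel. (\<lambda>n. indicat_real (cball 0 R) x * (convolution \<psi> (\<eta> (s n)) x - \<psi> x)) \<longlonglongrightarrow> 0"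
    using tendsto_L1_AE_subseq[of lborel "\<lambda>n x. indicat_real (cball 0 R) x * (convolution \<psi> (\<eta> n) x - \<psi> x)"]
      L1_limit[OF \<psi>, of R] by (auto simp: abs_mult)
  have s_lim: "AE x in lborel. norm x \<le> R \<longrightarrow> (\<lambda>n. u (s n) x) \<longlonglongrightarrow> \<psi> x"
    using s(2)
  proof eventually_elim
    case (elim x)
    show ?case
    proof
      assume "norm x \<le> R"
      then have "(\<lambda>n. u (s n) x - \<psi> x) \<longlonglongrightarrow> 0" using elim by (simp add: u_def)
      then show "(\<lambda>n. u (s n) x) \<longlonglongrightarrow> \<psi> x" by (rule LIM_zero_cancel)
    qed
  qed
  \<comment> \<open>The uniform bound \<open>M\<close> on the mollifications provides the
    domination. The exponent \<open>k\<close> is 2 in the quadratic terms and 1 where the other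
    factor \<psi> is hidden in \<open>h\<close>.\<close>
  have lim: "(\<lambda>n. \<integral>x. w x * (F x * u (s n) x ^ k) \<partial>lborel) \<longlonglongrightarrow> (\<integral>x. w x * (F x * \<psi> x ^ k) \<partial>lborel)"
    if w: "L1_loc w" and F: "test_fun F" and FR: "\<And>x. norm x > R \<Longrightarrow> F x = 0" for w F :: "'a \<Rightarrow> real" and k
  proof -
    obtain B where B: "\<And>x. \<bar>F x\<bar> \<le> B" using test_fun_bounded[OF F] by blast
    have Fm: "F \<in> borel_measurable borel" by (rule smooth_fun_measurable[OF test_fun_smooth[OF F]])
    show ?thesis
      using w
    proof (rule L1_loc_tendsto_integral[where B = "B * M ^ k" and R = R])
      show "(\<lambda>x. F x * u (s n) x ^ k) \<in> borel_measurable borel" for n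
        by (intro borel_measurable_times borel_measurable_power Fm smooth_fun_measurable us)
      show "(\<lambda>x. F x * \<psi> x ^ k) \<in> borel_measurable borel"
        by (intro borel_measurable_times borel_measurable_power Fm \<psi>m)
      show "\<bar>F x * u (s n) x ^ k\<bar> \<le> B * M ^ k" for n x
        unfolding abs_mult power_abs
        by (intro mult_mono power_mono B uM) (use B[of x] in auto)
      show "F x * u (s n) x ^ k = 0" if "norm x > R" for n x using FR[OF that] by simp
      show "AE x in lborel. (\<lambda>n. F x * u (s n) x ^ k) \<longlonglongrightarrow> F x * \<psi> x ^ k"
        using s_lim
      proof eventually_elim
        case (elim x)
        show ?case
        proof (cases "norm x \<le> R")
          case True
          with elim have "(\<lambda>n. u (s n) x) \<longlonglongrightarrow> \<psi> x" by blast
          then show ?thesis by (intro tendsto_intros)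
        qed (simp add: FR)
      qed
    qed
  qed
  have ff: "test_fun (\<lambda>x. (f x)\<^sup>2)" unfolding power2_eq_square by (intro test_fun_mult f fs)
  have gradR: "grad_sq f x = 0" if "norm x > R" for x
    using pd_zero_outside[OF R that] by (simp add: grad_sq_def)
  have T1: "(\<lambda>n. \<integral>x. (f x)\<^sup>2 * (u (s n) x)\<^sup>2 \<partial>lborel) \<longlonglongrightarrow> (\<integral>x. (f x)\<^sup>2 * (\<psi> x)\<^sup>2 \<partial>lborel)"
    using lim[OF L1_loc_const[of 1] ff, of 2] R by simp
  have T2: "(\<lambda>n. \<integral>x. grad_sq f x * (u (s n) x)\<^sup>2 \<partial>lborel) \<longlonglongrightarrow> (\<integral>x. grad_sq f x * (\<psi> x)\<^sup>2 \<partial>lborel)"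
    using lim[OF L1_loc_const[of 1] test_fun_grad_sq[OF f] gradR, of 2] by simp
  have T3: "(\<lambda>n. \<integral>x. W x * ((f x)\<^sup>2 * (u (s n) x)\<^sup>2) \<partial>lborel) \<longlonglongrightarrow> (\<integral>x. W x * ((f x)\<^sup>2 * (\<psi> x)\<^sup>2) \<partial>lborel)"
    using lim[OF W ff, of 2] R by simp
  have T4: "(\<lambda>n. \<integral>x. h x * ((f x)\<^sup>2 * u (s n) x) \<partial>lborel) \<longlonglongrightarrow> (\<integral>x. h x * ((f x)\<^sup>2 * \<psi> x) \<partial>lborel)"
    using lim[OF h ff, of 1] R by simp
  obtain B where B: "B > 0" "\<And>x. \<bar>(f x)\<^sup>2\<bar> \<le> B" using test_fun_bounded[OF ff] by blast
  \<comment> \<open>In this term both factors \<open>u n\<close> and the mollified \<open>h\<close>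
    vary, and the second converges only in L1. Replacing it by \<open>h\<close> costs at most
    \<open>B * M\<close> times the L1 error on the ball; what remains has a fixed weight and is
    covered by \<open>T4\<close>.\<close>
  define err where "err n = (\<integral>x. (f x)\<^sup>2 * u n x * convolution h (\<eta> n) x \<partial>lborel)
      - (\<integral>x. h x * ((f x)\<^sup>2 * u n x) \<partial>lborel)" for n
  have err: "\<bar>err n\<bar> \<le> B * M * (\<integral>x. indicat_real (cball 0 R) x * \<bar>convolution h (\<eta> n) x - h x\<bar> \<partial>lborel)" for n
  proof -
    have ffu: "test_fun (\<lambda>x. (f x)\<^sup>2 * u n x)" by (rule test_fun_mult(1)[OF ff us])
    have i1: "integrable lborel (\<lambda>x. (f x)\<^sup>2 * u n x * convolution h (\<eta> n) x)"
      by (intro integrable_test_fun test_fun_mult(1)[OF ffu] smooth_fun_convolution h \<eta>)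
    note i2 = L1_loc_integrable_test_fun[OF h ffu]
    have "err n = (\<integral>x. (f x)\<^sup>2 * u n x * convolution h (\<eta> n) x - h x * ((f x)\<^sup>2 * u n x) \<partial>lborel)"
      unfolding err_def using i1 i2 by simp
    also have "\<bar>\<dots>\<bar> \<le> (\<integral>x. B * M * (indicat_real (cball 0 R) x * \<bar>convolution h (\<eta> n) x - h x\<bar>) \<partial>lborel)"
    proof (rule integral_abs_bound_integral)
      show "integrable lborel (\<lambda>x. (f x)\<^sup>2 * u n x * convolution h (\<eta> n) x - h x * ((f x)\<^sup>2 * u n x))"
        using i1 i2 by (rule Bochner_Integration.integrable_diff)
      show "integrable lborel (\<lambda>x. B * M * (indicat_real (cball 0 R) x * \<bar>convolution h (\<eta> n) x - h x\<bar>))"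
        using integrable_abs[OF L1_limit(1)[OF h, of R n]] by (simp add: abs_mult)
      fix x :: 'a
      have "\<bar>(f x)\<^sup>2 * u n x\<bar> \<le> B * M * indicat_real (cball 0 R) x"
      proof (cases "norm x \<le> R")
        case True
        have "\<bar>(f x)\<^sup>2\<bar> * \<bar>u n x\<bar> \<le> B * M" using B(1) by (intro mult_mono B(2) uM) auto
        then show ?thesis using True by (simp add: abs_mult)
      qed (simp add: R)
      then have "\<bar>(f x)\<^sup>2 * u n x\<bar> * \<bar>convolution h (\<eta> n) x - h x\<bar>
          \<le> B * M * indicat_real (cball 0 R) x * \<bar>convolution h (\<eta> n) x - h x\<bar>"
        by (intro mult_right_mono) auto
      then show "\<bar>(f x)\<^sup>2 * u n x * convolution h (\<eta> n) x - h x * ((f x)\<^sup>2 * u n x)\<bar>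
          \<le> B * M * (indicat_real (cball 0 R) x * \<bar>convolution h (\<eta> n) x - h x\<bar>)"
        by (simp add: abs_mult[symmetric] algebra_simps)
    qed
    finally show ?thesis by simp
  qed
  have "err \<longlonglongrightarrow> 0"
  proof (rule Lim_null_comparison)
    show "(\<lambda>n. B * M * (\<integral>x. indicat_real (cball 0 R) x * \<bar>convolution h (\<eta> n) x - h x\<bar> \<partial>lborel)) \<longlonglongrightarrow> 0"
      by (intro tendsto_mult_right_zero L1_limit(2) h)
  qed (simp add: err)
  then have "(\<lambda>n. err (s n)) \<longlonglongrightarrow> 0"
    using LIMSEQ_subseq_LIMSEQ[OF _ s(1)] by (auto simp: o_def)
  then have T5: "(\<lambda>n. \<integral>x. (f x)\<^sup>2 * u (s n) x * convolution h (\<eta> (s n)) x \<partial>lborel) \<longlonglongrightarrow>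
      (\<integral>x. h x * ((f x)\<^sup>2 * \<psi> x) \<partial>lborel)"
    using tendsto_add[OF _ T4, of "\<lambda>n. err (s n)" 0] by (simp add: err_def)
  have "E * (\<integral>x. (f x)\<^sup>2 * (\<psi> x)\<^sup>2 \<partial>lborel)
      \<le> (\<integral>x. grad_sq f x * (\<psi> x)\<^sup>2 \<partial>lborel) - (\<integral>x. h x * ((f x)\<^sup>2 * \<psi> x) \<partial>lborel)
        + (\<integral>x. W x * ((f x)\<^sup>2 * (\<psi> x)\<^sup>2) \<partial>lborel)"
    by (rule LIMSEQ_le[OF tendsto_mult_left[OF T1] tendsto_add[OF tendsto_diff[OF T2 T5] T3]])
      (use ineq in auto)
  \<comment> \<open>Since \<open>h * \<psi>\<close> equals \<open>(Q - E) * \<psi>^2\<close>, the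
    limit inequality already contains the potential \<open>W - Q\<close>.\<close>
  moreover have "(\<integral>x. (W x - Q x) * ((f x)\<^sup>2 * (\<psi> x)\<^sup>2) \<partial>lborel)
      = (\<integral>x. W x * ((f x)\<^sup>2 * (\<psi> x)\<^sup>2) \<partial>lborel) - (\<integral>x. h x * ((f x)\<^sup>2 * \<psi> x) \<partial>lborel)
        - E * (\<integral>x. (f x)\<^sup>2 * (\<psi> x)\<^sup>2 \<partial>lborel)"
  proof -
    have i: "integrable lborel (\<lambda>x. w x * ((f x)\<^sup>2 * \<psi> x ^ k))" if "L1_loc w" for w k
    proof -
      have "L1_loc (\<lambda>x. w x * \<psi> x ^ k)"
        using M by (intro L1_loc_mult_bounded[where B = "M ^ k"] that borel_measurable_power \<psi>m)
          (auto simp: power_abs intro: power_mono)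
      from L1_loc_integrable_test_fun[OF this ff] show ?thesis by (simp add: mult_ac)
    qed
    have iW: "integrable lborel (\<lambda>x. W x * ((f x)\<^sup>2 * (\<psi> x)\<^sup>2))" by (rule i[OF W])
    have ih: "integrable lborel (\<lambda>x. h x * ((f x)\<^sup>2 * \<psi> x))" using i[OF h, of 1] by simp
    have i1: "integrable lborel (\<lambda>x. E * ((f x)\<^sup>2 * (\<psi> x)\<^sup>2))" by (rule i[OF L1_loc_const])
    have "(\<integral>x. (W x - Q x) * ((f x)\<^sup>2 * (\<psi> x)\<^sup>2) \<partial>lborel)
        = (\<integral>x. W x * ((f x)\<^sup>2 * (\<psi> x)\<^sup>2) - h x * ((f x)\<^sup>2 * \<psi> x) - E * ((f x)\<^sup>2 * (\<psi> x)\<^sup>2) \<partial>lborel)"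
      by (intro Bochner_Integration.integral_cong) (auto simp: h_def power2_eq_square algebra_simps)
    also have "\<dots> = (\<integral>x. W x * ((f x)\<^sup>2 * (\<psi> x)\<^sup>2) \<partial>lborel) - (\<integral>x. h x * ((f x)\<^sup>2 * \<psi> x) \<partial>lborel)
        - (\<integral>x. E * ((f x)\<^sup>2 * (\<psi> x)\<^sup>2) \<partial>lborel)"
      unfolding Bochner_Integration.integral_diff[OF Bochner_Integration.integrable_diff[OF iW ih] i1]
        Bochner_Integration.integral_diff[OF iW ih] ..
    finally show ?thesis by simp
  qed
  ultimately show ?thesis by simp
qed

text \<open>Orthogonality to reflected mollifiers makes every mollification of \<open>v\<close>
  vanish identically, yet these converge to \<open>v\<close> in L1 on each ball.\<close>

lemma AE_eq_0_if_orthogonal_test_funs: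
  fixes v :: "'a::euclidean_space \<Rightarrow> real"
  assumes v: "L1_loc v" and orth: "\<And>g. test_fun g \<Longrightarrow> (\<integral>x. v x * g x \<partial>lborel) = 0"
  shows "AE x in lborel. v x = 0"
proof -
  obtain \<eta> :: "nat \<Rightarrow> 'a \<Rightarrow> real" and r where
    \<eta>: "\<And>n. test_fun (\<eta> n)" and pos: "\<And>n y. 0 \<le> \<eta> n y" and one: "\<And>n. (\<integral>y. \<eta> n y \<partial>lborel) = 1"
    and supp: "\<And>n y. norm y > r n \<Longrightarrow> \<eta> n y = 0" and r: "r \<longlonglongrightarrow> 0"
    using mollifier_exists by blast
  have zero: "convolution v (\<eta> n) x = 0" for n x
    unfolding convolution_def by (intro orth test_fun_reflect \<eta>)
  have ae: "AE x in lborel. indicat_real (cball 0 (real N)) x * \<bar>v x\<bar> = 0" for N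
  proof -
    have "(\<lambda>n::nat. \<integral>x. indicat_real (cball 0 (real N)) x * \<bar>v x\<bar> \<partial>lborel) \<longlonglongrightarrow> 0"
      using tendsto_convolution_L1(2)[where \<eta> = \<eta> and r = r, OF v \<eta> pos one supp r, of "real N"] by (simp add: zero)
    then have "(\<integral>x. indicat_real (cball 0 (real N)) x * \<bar>v x\<bar> \<partial>lborel) = 0"
      by (simp add: LIMSEQ_const_iff)
    then show ?thesis
      using integral_nonneg_eq_0_iff_AE[OF L1_loc_set_integrable[OF v]] by simp
  qed
  have "AE x in lborel. \<forall>N. indicat_real (cball 0 (real N)) x * \<bar>v x\<bar> = 0"
    unfolding AE_all_countable by (intro allI ae)
  then show ?thesis
  proof eventually_elim
    case (elim x)
    obtain N where "norm x \<le> real N" using real_arch_simple by blast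
    then show ?case using elim[rule_format, of N] by simp
  qed
qed

section \<open>Polarization of the form bound\<close>

lemma grad_sq_linear:
  fixes f g :: "'a::euclidean_space \<Rightarrow> real"
  assumes f: "smooth_fun f" and g: "smooth_fun g"
  shows "grad_sq (\<lambda>x. s * f x + t * g x) x + grad_sq (\<lambda>x. s * f x + (- t) * g x) x
    = 2 * s\<^sup>2 * grad_sq f x + 2 * t\<^sup>2 * grad_sq g x"
proof -
  have pd: "pd b (\<lambda>x. s * f x + t * g x) x = s * pd b f x + t * pd b g x" if "b \<in> Basis" for b s t
    using that smooth_fun_mult[OF smooth_fun_const f] smooth_fun_mult[OF smooth_fun_const g]
    by (simp add: pd_add pd_cmult f g)
  have "grad_sq (\<lambda>x. s * f x + t * g x) x + grad_sq (\<lambda>x. s * f x + (- t) * g x) x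
      = (\<Sum>b\<in>Basis. (s * pd b f x + t * pd b g x)\<^sup>2 + (s * pd b f x + (- t) * pd b g x)\<^sup>2)"
    unfolding grad_sq_def sum.distrib[symmetric] by (intro sum.cong refl) (simp only: pd)
  also have "\<dots> = (\<Sum>b\<in>Basis. 2 * s\<^sup>2 * (pd b f x)\<^sup>2 + 2 * t\<^sup>2 * (pd b g x)\<^sup>2)"
    by (intro sum.cong refl) (simp add: power2_eq_square algebra_simps)
  finally show ?thesis by (simp add: grad_sq_def sum.distrib sum_distrib_left)
qed

text \<open>Apply the bound to s f + g/s and s f - g/s. The difference of the two squares is 4 f g,
  free of s, while the parallelogram law adds up the energies without a mixed term.\<close>

lemma form_bound_polarization:
  fixes v p :: "'a::euclidean_space \<Rightarrow> real"
  assumes v: "L1_loc v" and p: "L1_loc p"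
    and bound: "\<And>f. test_fun f \<Longrightarrow> \<bar>\<integral>x. v x * (f x)\<^sup>2 \<partial>lborel\<bar> \<le> (\<integral>x. p x * grad_sq f x \<partial>lborel)"
    and f: "test_fun f" and g: "test_fun g" and s: "s \<noteq> 0"
  shows "2 * \<bar>\<integral>x. v x * (f x * g x) \<partial>lborel\<bar>
    \<le> s\<^sup>2 * (\<integral>x. p x * grad_sq f x \<partial>lborel) + (1 / s)\<^sup>2 * (\<integral>x. p x * grad_sq g x \<partial>lborel)"
proof -
  define h where "h t x = s * f x + t * g x" for t x
  have fs: "smooth_fun f" "smooth_fun g" using f g by (auto intro: test_fun_smooth)
  have h: "test_fun (h t)" for t unfolding h_def
    by (intro test_fun_add test_fun_mult(2) f g smooth_fun_const)
  have hh: "test_fun (\<lambda>x. (h t x)\<^sup>2)" for t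
    unfolding power2_eq_square by (intro test_fun_mult h test_fun_smooth)
  have "4 * (\<integral>x. v x * (f x * g x) \<partial>lborel) = (\<integral>x. v x * (h (1/s) x)\<^sup>2 - v x * (h (- (1/s)) x)\<^sup>2 \<partial>lborel)"
    unfolding integral_mult_right_zero[symmetric]
    by (intro Bochner_Integration.integral_cong) (use s in \<open>auto simp: h_def power2_eq_square field_simps\<close>)
  also have "\<dots> = (\<integral>x. v x * (h (1/s) x)\<^sup>2 \<partial>lborel) - (\<integral>x. v x * (h (- (1/s)) x)\<^sup>2 \<partial>lborel)"
    by (intro Bochner_Integration.integral_diff L1_loc_integrable_test_fun v hh)
  finally have "4 * \<bar>\<integral>x. v x * (f x * g x) \<partial>lborel\<bar>
      \<le> (\<integral>x. p x * grad_sq (h (1/s)) x \<partial>lborel) + (\<integral>x. p x * grad_sq (h (- (1/s))) x \<partial>lborel)"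
    using bound[OF h, of "1/s"] bound[OF h, of "- (1/s)"] by linarith
  also have "\<dots> = (\<integral>x. p x * grad_sq (h (1/s)) x + p x * grad_sq (h (- (1/s))) x \<partial>lborel)"
    by (intro Bochner_Integration.integral_add[symmetric] L1_loc_integrable_test_fun p test_fun_grad_sq h)
  also have "\<dots> = (\<integral>x. 2 * s\<^sup>2 * (p x * grad_sq f x) + 2 * (1/s)\<^sup>2 * (p x * grad_sq g x) \<partial>lborel)"
    unfolding distrib_left[symmetric] h_def grad_sq_linear[OF fs]
    by (intro Bochner_Integration.integral_cong) (auto simp: algebra_simps)
  also have "\<dots> = 2 * s\<^sup>2 * (\<integral>x. p x * grad_sq f x \<partial>lborel) + 2 * (1/s)\<^sup>2 * (\<integral>x. p x * grad_sq g x \<partial>lborel)"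
    using L1_loc_integrable_test_fun[OF p test_fun_grad_sq[OF f]] L1_loc_integrable_test_fun[OF p test_fun_grad_sq[OF g]]
    by (subst Bochner_Integration.integral_add) (auto simp del: power_divide)
  finally show ?thesis by simp
qed

text \<open>Testing the form bound against \<open>f\<^sub>n\<close> and a fixed \<open>g\<close>, where the cutoffs \<open>f\<^sub>n\<close> tend to a
  nonzero constant with vanishing energy.\<close>
lemma form_bounded_imp_AE_eq_0:
  fixes v p :: "'a::euclidean_space \<Rightarrow> real"
  assumes dim: "DIM('a) \<le> 2"
    and v: "L1_loc v" and p: "L1_loc p" and p_bound: "\<And>x. 0 \<le> p x" "\<And>x. p x \<le> K"
    and bound: "\<And>f. test_fun f \<Longrightarrow> \<bar>\<integral>x. v x * (f x)\<^sup>2 \<partial>lborel\<bar> \<le> (\<integral>x. p x * grad_sq f x \<partial>lborel)"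
  shows "AE x in lborel. v x = 0"
proof (rule AE_eq_0_if_orthogonal_test_funs[OF v])
  fix g :: "'a \<Rightarrow> real" assume g: "test_fun g"
  define f where "f n = (log_cutoff (1 / real (Suc n)) :: 'a \<Rightarrow> real)" for n
  have f: "test_fun (f n)" for n unfolding f_def by (rule test_fun_log_cutoff) simp
  let ?a = "\<lambda>f. \<integral>x. p x * grad_sq f x \<partial>lborel"
  \<comment> \<open>The weight lies between 0 and \<open>K\<close>, so the weighted energy is
    controlled by the plain Dirichlet energy of the cutoffs.\<close>
  have a0: "(\<lambda>n. ?a (f n)) \<longlonglongrightarrow> 0"
  proof (rule Lim_null_comparison)
    have gs: "grad_sq (f n) x \<ge> 0" for n x by (simp add: grad_sq_def sum_nonneg)
    have "(\<lambda>n. K * (\<integral>x. grad_sq (f n) x \<partial>lborel)) \<longlonglongrightarrow> K * 0"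
      unfolding f_def grad_sq_def by (intro tendsto_intros log_cutoff_energy dim)
    then show "(\<lambda>n. K * (\<integral>x. grad_sq (f n) x \<partial>lborel)) \<longlonglongrightarrow> 0" by simp
    have "\<bar>?a (f n)\<bar> \<le> (\<integral>x. K * grad_sq (f n) x \<partial>lborel)" for n
      using p_bound gs[of n]
      by (intro integral_abs_bound_integral L1_loc_integrable_test_fun p L1_loc_const test_fun_grad_sq f)
        (auto simp: abs_mult intro: mult_right_mono)
    then show "eventually (\<lambda>n. norm (?a (f n)) \<le> K * (\<integral>x. grad_sq (f n) x \<partial>lborel)) sequentially"
      by simp
  qed
  obtain R where R: "\<And>x. norm x > R \<Longrightarrow> g x = 0" using test_fun_support[OF g] by blast
  obtain B where B: "\<And>x. \<bar>g x\<bar> \<le> B" using test_fun_bounded[OF g] by blast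
  have gm: "g \<in> borel_measurable borel" by (rule smooth_fun_measurable[OF test_fun_smooth[OF g]])
  \<comment> \<open>The supports of the cutoffs grow without bound, but the fixed factor
    \<open>g\<close> keeps the products in one ball.\<close>
  have lim: "(\<lambda>n. \<integral>x. v x * (f n x * g x) \<partial>lborel) \<longlonglongrightarrow> (\<integral>x. v x * (exp (- 1) * g x) \<partial>lborel)"
    using v
  proof (rule L1_loc_tendsto_integral[where R = R and B = B])
    show "(\<lambda>x. f n x * g x) \<in> borel_measurable borel" for n
      by (intro borel_measurable_times gm smooth_fun_measurable test_fun_smooth f)
    show "(\<lambda>x. exp (- 1) * g x) \<in> borel_measurable borel" using gm by simp
    show "\<bar>f n x * g x\<bar> \<le> B" for n x
    proof -
      have "0 \<le> f n x" "f n x \<le> 1" unfolding f_def by (intro log_cutoff_bounds; simp)+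
      then have "\<bar>f n x\<bar> * \<bar>g x\<bar> \<le> 1 * B" using B[of x] by (intro mult_mono) auto
      then show ?thesis by (simp add: abs_mult)
    qed
    show "f n x * g x = 0" if "norm x > R" for n x using R[OF that] by simp
    have "(\<lambda>n. f n x * g x) \<longlonglongrightarrow> exp (- 1) * g x" for x
      unfolding f_def by (intro tendsto_intros tendsto_log_cutoff)
    then show "AE x in lborel. (\<lambda>n. f n x * g x) \<longlonglongrightarrow> exp (- 1) * g x" by simp
  qed
  let ?c = "\<integral>x. v x * (exp (- 1) * g x) \<partial>lborel"
  \<comment> \<open>The scale is the square root of \<open>Suc m\<close>. For fixed \<open>m\<close>
    the limit in \<open>n\<close> removes the energy of the cutoffs despite its factor
    \<open>Suc m\<close>; only afterwards does \<open>m\<close> tend to infinity and remove the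
    energy of \<open>g\<close>.\<close>
  have le: "2 * \<bar>?c\<bar> \<le> 1 / real (Suc m) * ?a g" for m
  proof (rule LIMSEQ_le)
    show "(\<lambda>n. 2 * \<bar>\<integral>x. v x * (f n x * g x) \<partial>lborel\<bar>) \<longlonglongrightarrow> 2 * \<bar>?c\<bar>"
      by (intro tendsto_intros lim)
    have "(\<lambda>n. real (Suc m) * ?a (f n) + 1 / real (Suc m) * ?a g) \<longlonglongrightarrow> real (Suc m) * 0 + 1 / real (Suc m) * ?a g"
      by (intro tendsto_intros a0)
    then show "(\<lambda>n. real (Suc m) * ?a (f n) + 1 / real (Suc m) * ?a g) \<longlonglongrightarrow> 1 / real (Suc m) * ?a g" by simp
    have "2 * \<bar>\<integral>x. v x * (f n x * g x) \<partial>lborel\<bar> \<le> real (Suc m) * ?a (f n) + 1 / real (Suc m) * ?a g" for n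
      using form_bound_polarization[OF v p bound f g, of "sqrt (real (Suc m))" n]
      by (simp add: power_divide)
    then show "\<exists>N. \<forall>n\<ge>N. 2 * \<bar>\<integral>x. v x * (f n x * g x) \<partial>lborel\<bar> \<le> real (Suc m) * ?a (f n) + 1 / real (Suc m) * ?a g"
      by blast
  qed
  have "2 * \<bar>?c\<bar> \<le> 0 * ?a g"
    by (rule LIMSEQ_le_const[OF tendsto_mult_right[OF LIMSEQ_Suc[OF lim_1_over_n]]]) (use le in auto)
  then have "?c = 0" by simp
  moreover have "?c = exp (- 1) * (\<integral>x. v x * g x \<partial>lborel)"
    unfolding integral_mult_right_zero[symmetric] by (simp only: mult_ac)
  ultimately show "(\<integral>x. v x * g x \<partial>lborel) = 0" by simp
qed

theorem theorem1p5:
  fixes Q V \<psi> :: "'a::euclidean_space \<Rightarrow> real" and E0 :: real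
  assumes dim: "DIM('a) \<in> {1, 2}"
    and Q: "L2_loc Q"
    and bb: "bounded_below_op Q"
    and E0: "E0 = ground_state_energy Q"
    and psi_bdd: "bounded (range \<psi>)"
    and psi_pos: "\<forall>x. \<psi> x > 0"
    and psi_W: "W11_loc \<psi>"
    and psi_eq: "\<forall>\<phi>::'a \<Rightarrow> real. test_fun \<phi> \<longrightarrow>
        (\<integral>x. - \<psi> x * laplacian \<phi> x + Q x * \<psi> x * \<phi> x \<partial>lborel)
          = E0 * (\<integral>x. \<psi> x * \<phi> x \<partial>lborel)"
    and V: "L2_loc V"
    and plus: "\<forall>\<phi>::'a \<Rightarrow> complex. test_fun \<phi> \<longrightarrow>
        qform (\<lambda>x. Q x + V x) \<phi> \<ge> E0 * L2normsq \<phi>"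
    and minus: "\<forall>\<phi>::'a \<Rightarrow> complex. test_fun \<phi> \<longrightarrow>
        qform (\<lambda>x. Q x - V x) \<phi> \<ge> E0 * L2normsq \<phi>"
  shows "AE x in lborel. V x = 0"
proof -
  have Q1: "L1_loc Q" and V1: "L1_loc V" using Q V by (auto intro: L2_loc_imp_L1_loc)
  have V1': "L1_loc (\<lambda>x. - V x)"
    using V1 by (rule L1_loc_dominated[where B = 1]) (use L1_loc_measurable[OF V1] in auto)
  have \<psi>1: "L1_loc \<psi>" using psi_W by (simp add: W11_loc_def)
  have \<psi>m: "\<psi> \<in> borel_measurable borel" by (rule L1_loc_measurable[OF \<psi>1])
  obtain M where M: "\<And>x. \<bar>\<psi> x\<bar> \<le> M" using psi_bdd by (auto simp: bounded_iff)
  have M2: "\<bar>(\<psi> x)\<^sup>2\<bar> \<le> M\<^sup>2" for x using power_mono[OF M[of x], of 2] by simp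
  have \<psi>2m: "(\<lambda>x. (\<psi> x)\<^sup>2) \<in> borel_measurable borel" using \<psi>m by measurable
  \<comment> \<open>\<open>v\<close> is the density of the form b, and \<open>p\<close> is the
    weight in the energy a.\<close>
  define v where "v x = V x * (\<psi> x)\<^sup>2" for x
  define p where "p x = (\<psi> x)\<^sup>2" for x
  have v: "L1_loc v" unfolding v_def[abs_def] by (rule L1_loc_mult_bounded[OF V1 \<psi>2m M2])
  have p: "L1_loc p"
    unfolding p_def[abs_def] using L1_loc_mult_bounded[OF L1_loc_const[of 1] \<psi>2m M2] by simp
  have "AE x in lborel. v x = 0"
  proof (rule form_bounded_imp_AE_eq_0[OF _ v p])
    show "DIM('a) \<le> 2" using dim by auto
    show "0 \<le> p x" "p x \<le> M\<^sup>2" for x using M2[of x] by (auto simp: p_def)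
    fix f :: "'a \<Rightarrow> real" assume f: "test_fun f"
    have W: "L1_loc (\<lambda>x. Q x + V x)" "L1_loc (\<lambda>x. Q x - V x)"
      using L1_loc_add[OF Q1 V1] L1_loc_add[OF Q1 V1'] by simp_all
    \<comment> \<open>Here \<open>W - Q\<close> is V and then -V, so the two inequalities bound b(f,
      f) from below and from above by the energy.\<close>
    have "0 \<le> (\<integral>x. grad_sq f x * (\<psi> x)\<^sup>2 \<partial>lborel) + (\<integral>x. ((Q x + V x) - Q x) * ((f x)\<^sup>2 * (\<psi> x)\<^sup>2) \<partial>lborel)"
      by (rule ground_state_form_nonneg[OF Q1 W(1) \<psi>1 M _ _ f]) (use psi_eq plus in auto)
    moreover have "0 \<le> (\<integral>x. grad_sq f x * (\<psi> x)\<^sup>2 \<partial>lborel) + (\<integral>x. ((Q x - V x) - Q x) * ((f x)\<^sup>2 * (\<psi> x)\<^sup>2) \<partial>lborel)"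
      by (rule ground_state_form_nonneg[OF Q1 W(2) \<psi>1 M _ _ f]) (use psi_eq minus in auto)
    ultimately show "\<bar>\<integral>x. v x * (f x)\<^sup>2 \<partial>lborel\<bar> \<le> (\<integral>x. p x * grad_sq f x \<partial>lborel)"
      by (simp add: v_def p_def mult_ac)
  qed
  \<comment> \<open>The factor \<psi>^2 is positive at every point and can be cancelled.\<close>
  then show ?thesis
  proof eventually_elim
    case (elim x)
    then show ?case using psi_pos[rule_format, of x] by (simp add: v_def)
  qed
qed

end
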